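(* Let $(M,h^M)$ be a three-dimensional oriented Riemannian manifold and let $\alpha:S^1\to M$ be an embedding parameterized by arclength, with image $\Sigma=\alpha(S^1)$, such that $(\mathrm{Trace}\,\Pi_\Sigma)(\alpha(s))\ne0$ for all $s\in S^1$, where $\Pi_\Sigma$ is the second fundamental form of $\Sigma$ in $M$. Let $(T,N,B)$ be the Frenet frame along $\alpha$, and $\kappa,\tau:S^1\to\mathbb{R}$ its curvature and torsion. Let $F\to\Sigma$ be the complex vector bundle with fiber $$F_{\alpha(s)}=\mathrm{Vect}_{\mathbb{C}}\{T,\;N+iB\}\subseteq T_{\alpha(s)}M^{\mathbb{C}},$$ where $T_{\alpha(s)}M^{\mathbb{C}}$ is the complexification of $T_{\alpha(s)}M$, endowed with the Hermitian structure $h^F$ and compatible connection $\nabla^F$ induced by $h^M$ and its Levi-Civita connection, and let $\theta^F\in\Omega^1(\mathcal{F}F,\mathfrak{u}(2))$ be the associated connection form on the orthonormal (unitary) frame bundle $\mathcal{F}F$ of $F$. Let $\mathcal{B}:S^1\to\mathcal{F}F$ be the moving frame over $\Sigma$ defined by $$\mathcal{B}(s)=\left\{T,\;e^{i\int_0^s\tau(x)\,dx}\,\frac{N+iB}{\sqrt2}\right\},\qquad s\in S^1.$$ Then, for $s_0\in S^1$, $$\theta^F_{\mathcal{B}(s_0)}\left(\frac{d}{ds}\bigg|_{s_0}\mathcal{B}(s)\right)=\frac{1}{\sqrt2}\begin{pmatrix}0&-\psi(s_0)\\ \overline{\psi}(s_0)&0\end{pmatrix}\in\mathfrak{u}(2),$$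 where $\psi$ is Hasimoto's function $\psi(s)=\kappa(s)\,e^{i\int_0^s\tau(x)\,dx}$. Hence $\psi$ measures the infinitesimal rotation of the moving frame $\mathcal{B}$ over $\Sigma$.
   Context: Frenet frame: $T=\dot\alpha/\|\dot\alpha\|$, $N=\mathrm{Trace}\,\Pi_\Sigma/\|\mathrm{Trace}\,\Pi_\Sigma\|$ (the trace of the second fundamental form is a normal vector field along $\Sigma$), $B=T\times N$, where $\times$ is the cross product determined by the metric and orientation. The curvature $\kappa$ and torsion $\tau$ are the smooth real functions on $S^1$ determined by $\frac{D}{\partial s}T=\kappa N$, $\frac{D}{\partial s}N=-\kappa T+\tau B$, $\frac{D}{\partial s}B=-\tau N$, where $\frac{D}{\partial s}$ is the covariant derivative along $\alpha$ induced by the Levi-Civita connection $\nabla$. Induced structures on $F$: $h^F$ is the restriction to $F$ of the Hermitian extension of $h^M$ to the complexification of $TM|_\Sigma$ (complex linear in the first argument, conjugate linear in the second); $\nabla^F$ is the complex-linear extension of $\nabla$ followed by the orthogonal projection onto $F$. Moving frame: a smooth curve, more precisely a loop, in the orthonormal frame bundle. Connection form: for a Hermitian vector bundle $(E,h^E)$ of rank $k$ with compatible connection $\nabla^E$, the frame bundle $\mathcal{F}E$ is the $U(k)$-principal bundle of orthonormal frames of the fibers. If $A(t)=\{A^1(t),\dots,A^k(t)\}$ is a smooth curve in $\mathcal{F}E$ over a curve $\alpha(t)$ in the base, then $$\theta^E_{A(t_0)}\left(\frac{d}{dt}\bigg|_{t_0}A(t)\right)=\left(h^E\left(\nabla^E_{\dot\alpha(t_0)}A^j,\;A^i(t_0)\right)\right)_{1\le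 i,j\le k},$$ with row index $i$ and column index $j$. *)

theory Defs
  imports "HOL-Analysis.Analysis" "HOL-Library.Function_Algebras"
begin

instantiation "fun" :: (type, real_vector) real_vector
begin

definition scaleR_fun :: "real \<Rightarrow> ('a \<Rightarrow> 'b) \<Rightarrow> 'a \<Rightarrow> 'b"
  where "scaleR_fun r f = (\<lambda>x. r *\<^sub>R f x)"

instance
  by standard
    (simp_all add: scaleR_fun_def plus_fun_def fun_eq_iff scaleR_add_right scaleR_add_left)

end


section \<open>Smooth maps between Euclidean spaces\<close>

text \<open>Only used for open sets \<open>S\<close>.\<close>

primrec Ck_on :: "nat \<Rightarrow> ('a::real_normed_vector \<Rightarrow> 'b::real_normed_vector) \<Rightarrow> 'a set \<Rightarrow> bool"
  where
    "Ck_on 0 f S \<longleftrightarrow> continuous_on S f"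
  | "Ck_on (Suc k) f S \<longleftrightarrow>
       (\<forall>x\<in>S. f differentiable (at x)) \<and> (\<forall>v. Ck_on k (\<lambda>x. frechet_derivative f (at x) v) S)"

definition smooth_on :: "'a::real_normed_vector set \<Rightarrow> ('a \<Rightarrow> 'b::real_normed_vector) \<Rightarrow> bool"
  where "smooth_on S f \<longleftrightarrow> (\<forall>k. Ck_on k f S)"


section \<open>Oriented Riemannian three-manifolds\<close>

text \<open>
  A chart is a pair of its domain and its coordinate map, of which only the values on the domain
  matter. The manifold is the union of the chart domains, an open subset of a Hausdorff second
  countable space.

  A tangent vector at \<open>p\<close> is the family of its components in all charts around \<open>p\<close>, related by the
  Jacobians of the coordinate changes. Components in charts that do not contain \<open>p\<close> are \<open>0\<close>, so
  that the tangent space at \<open>p\<close> is a three-dimensional linear subspace of a function space.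
\<close>

type_synonym 'm chart = "'m set \<times> ('m \<Rightarrow> real^3)"
type_synonym 'm tvec = "'m chart \<Rightarrow> real^3"
type_synonym 'm vfield = "'m \<Rightarrow> 'm tvec"

record 'm riem =
  Atlas :: "'m chart set"
  Metric :: "'m \<Rightarrow> 'm tvec \<Rightarrow> 'm tvec \<Rightarrow> real"

definition cinv :: "'m chart \<Rightarrow> real^3 \<Rightarrow> 'm"
  where "cinv c = inv_into (fst c) (snd c)"

definition carrier_of :: "'m riem \<Rightarrow> 'm set"
  where "carrier_of M = (\<Union>c\<in>Atlas M. fst c)"

definition charts_at :: "'m riem \<Rightarrow> 'm \<Rightarrow> 'm chart set"
  where "charts_at M p = {c \<in> Atlas M. p \<in> fst c}"

definition jac :: "'m chart \<Rightarrow> 'm chart \<Rightarrow> 'm \<Rightarrow> real^3 \<Rightarrow> real^3"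
  where "jac c d p = frechet_derivative (snd d \<circ> cinv c) (at (snd c p))"

definition oriented_atlas :: "'m::{t2_space, second_countable_topology} chart set \<Rightarrow> bool"
  where "oriented_atlas A \<longleftrightarrow>
    (\<forall>c\<in>A. open (fst c) \<and> open (snd c ` fst c) \<and>
        homeomorphism (fst c) (snd c ` fst c) (snd c) (cinv c)) \<and>
    (\<forall>c\<in>A. \<forall>d\<in>A. smooth_on (snd c ` (fst c \<inter> fst d)) (snd d \<circ> cinv c)) \<and>
    (\<forall>c\<in>A. \<forall>d\<in>A. \<forall>p\<in>fst c \<inter> fst d. det (matrix (jac c d p)) > 0)"

definition tangent_space :: "'m riem \<Rightarrow> 'm \<Rightarrow> 'm tvec set"
  where "tangent_space M p =
    {v. (\<forall>c\<in>charts_at M p. \<forall>d\<in>charts_at M p. v d = jac c d p (v c)) \<and>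
        (\<forall>c. c \<notin> charts_at M p \<longrightarrow> v c = 0)}"

text \<open>The \<open>j\<close>-th coordinate vector field \<open>\<partial>/\<partial>x\<^sup>j\<close> of the chart \<open>c\<close>.\<close>

definition coord_field :: "'m riem \<Rightarrow> 'm chart \<Rightarrow> 3 \<Rightarrow> 'm vfield"
  where "coord_field M c j p = (\<lambda>d. if d \<in> charts_at M p then jac c d p (axis j 1) else 0)"

definition smooth_function_on :: "'m riem \<Rightarrow> 'm set \<Rightarrow> ('m \<Rightarrow> real) \<Rightarrow> bool"
  where "smooth_function_on M U f \<longleftrightarrow>
    (\<forall>c\<in>Atlas M. smooth_on (snd c ` (fst c \<inter> U)) (f \<circ> cinv c))"

definition smooth_field_on :: "'m riem \<Rightarrow> 'm set \<Rightarrow> 'm vfield \<Rightarrow> bool"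
  where "smooth_field_on M U Y \<longleftrightarrow>
    (\<forall>p\<in>U. Y p \<in> tangent_space M p) \<and>
    (\<forall>c\<in>Atlas M. smooth_on (snd c ` (fst c \<inter> U)) (\<lambda>x. Y (cinv c x) c))"

definition riemannian_metric ::
    "'m riem \<Rightarrow> ('m \<Rightarrow> 'm tvec \<Rightarrow> 'm tvec \<Rightarrow> real) \<Rightarrow> bool"
  where "riemannian_metric M h \<longleftrightarrow>
    (\<forall>p\<in>carrier_of M. \<forall>u\<in>tangent_space M p. \<forall>v\<in>tangent_space M p.
        h p u v = h p v u \<and>
        (\<forall>w\<in>tangent_space M p. h p (u + v) w = h p u w + h p v w) \<and>
        (\<forall>a. h p (a *\<^sub>R u) v = a * h p u v) \<and>
        (u \<noteq> 0 \<longrightarrow> h p u u > 0)) \<and>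
    (\<forall>c\<in>Atlas M. \<forall>i j.
        smooth_function_on M (fst c) (\<lambda>p. h p (coord_field M c i p) (coord_field M c j p)))"

definition oriented_riemannian_3_manifold ::
    "'m::{t2_space, second_countable_topology} riem \<Rightarrow> bool"
  where "oriented_riemannian_3_manifold M \<longleftrightarrow>
    oriented_atlas (Atlas M) \<and> riemannian_metric M (Metric M)"

definition tnorm :: "'m riem \<Rightarrow> 'm \<Rightarrow> 'm tvec \<Rightarrow> real"
  where "tnorm M p v = sqrt (Metric M p v v)"

definition volume_form :: "'m riem \<Rightarrow> 'm \<Rightarrow> 'm tvec \<Rightarrow> 'm tvec \<Rightarrow> 'm tvec \<Rightarrow> real"
  where "volume_form M p u v w =
    (let c = (SOME c. c \<in> charts_at M p);
         g = (\<chi> i j. Metric M p (coord_field M c i p) (coord_field M c j p)) :: real^3^3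
     in sqrt (det g) * det (vector [u c, v c, w c] :: real^3^3))"

definition cross_product :: "'m riem \<Rightarrow> 'm \<Rightarrow> 'm tvec \<Rightarrow> 'm tvec \<Rightarrow> 'm tvec"
  where "cross_product M p u v =
    (THE x. x \<in> tangent_space M p \<and>
      (\<forall>w\<in>tangent_space M p. Metric M p x w = volume_form M p u v w))"


section \<open>The Levi-Civita connection\<close>

text \<open>\<open>nabla p v Y\<close> is the derivative in direction \<open>v\<close>, a tangent vector at \<open>p\<close>, of a vector field
  \<open>Y\<close> that is smooth on some neighbourhood of \<open>p\<close>.\<close>

type_synonym 'm conn = "'m \<Rightarrow> 'm tvec \<Rightarrow> 'm vfield \<Rightarrow> 'm tvec"

definition dir_deriv :: "'m riem \<Rightarrow> 'm \<Rightarrow> 'm tvec \<Rightarrow> ('m \<Rightarrow> real) \<Rightarrow> real"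
  where "dir_deriv M p v f =
    (let c = (SOME c. c \<in> charts_at M p)
     in frechet_derivative (f \<circ> cinv c) (at (snd c p)) (v c))"

definition lie_bracket :: "'m riem \<Rightarrow> 'm vfield \<Rightarrow> 'm vfield \<Rightarrow> 'm vfield"
  where "lie_bracket M X Y p = (\<lambda>c. if c \<in> charts_at M p then
      frechet_derivative (\<lambda>x. Y (cinv c x) c) (at (snd c p)) (X p c)
      - frechet_derivative (\<lambda>x. X (cinv c x) c) (at (snd c p)) (Y p c)
    else 0)"

definition affine_connection :: "'m::topological_space riem \<Rightarrow> 'm conn \<Rightarrow> bool"
  where "affine_connection M nabla \<longleftrightarrow>
    (\<forall>U. open U \<and> U \<subseteq> carrier_of M \<longrightarrow>
      (\<forall>Y. smooth_field_on M U Y \<longrightarrow>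
        (\<forall>p\<in>U. \<forall>v\<in>tangent_space M p.
          nabla p v Y \<in> tangent_space M p \<and>
          (\<forall>w\<in>tangent_space M p. nabla p (v + w) Y = nabla p v Y + nabla p w Y) \<and>
          (\<forall>a. nabla p (a *\<^sub>R v) Y = a *\<^sub>R nabla p v Y) \<and>
          (\<forall>Z. smooth_field_on M U Z \<longrightarrow>
            nabla p v (\<lambda>q. Y q + Z q) = nabla p v Y + nabla p v Z) \<and>
          (\<forall>f. smooth_function_on M U f \<longrightarrow>
            nabla p v (\<lambda>q. f q *\<^sub>R Y q) = dir_deriv M p v f *\<^sub>R Y p + f p *\<^sub>R nabla p v Y) \<and>
          (\<forall>Z. (\<forall>q\<in>U. Z q = Y q) \<longrightarrow> nabla p v Z = nabla p v Y)) \<and>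
        (\<forall>X. smooth_field_on M U X \<longrightarrow> smooth_field_on M U (\<lambda>p. nabla p (X p) Y))))"

definition torsion_free :: "'m::topological_space riem \<Rightarrow> 'm conn \<Rightarrow> bool"
  where "torsion_free M nabla \<longleftrightarrow>
    (\<forall>U X Y. open U \<and> U \<subseteq> carrier_of M \<and> smooth_field_on M U X \<and> smooth_field_on M U Y \<longrightarrow>
      (\<forall>p\<in>U. nabla p (X p) Y - nabla p (Y p) X = lie_bracket M X Y p))"

definition metric_compatible :: "'m::topological_space riem \<Rightarrow> 'm conn \<Rightarrow> bool"
  where "metric_compatible M nabla \<longleftrightarrow>
    (\<forall>U Y Z. open U \<and> U \<subseteq> carrier_of M \<and> smooth_field_on M U Y \<and> smooth_field_on M U Z \<longrightarrow>
      (\<forall>p\<in>U. \<forall>v\<in>tangent_space M p.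
        dir_deriv M p v (\<lambda>q. Metric M q (Y q) (Z q)) =
          Metric M p (nabla p v Y) (Z p) + Metric M p (Y p) (nabla p v Z)))"

definition levi_civita :: "'m::topological_space riem \<Rightarrow> 'm conn \<Rightarrow> bool"
  where "levi_civita M nabla \<longleftrightarrow>
    affine_connection M nabla \<and> torsion_free M nabla \<and> metric_compatible M nabla"


section \<open>Curves\<close>

text \<open>
  The circle of length \<open>L\<close> is \<open>\<real>/L\<int>\<close>; a map on it is given by its lift to \<open>\<real>\<close>, and its
  points by \<open>cis (2 \<pi> s / L)\<close>.
\<close>

definition smooth_curve :: "'m::topological_space riem \<Rightarrow> (real \<Rightarrow> 'm) \<Rightarrow> bool"
  where "smooth_curve M \<alpha> \<longleftrightarrow>
    range \<alpha> \<subseteq> carrier_of M \<and> continuous_on UNIV \<alpha> \<and>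
    (\<forall>c\<in>Atlas M. smooth_on {s. \<alpha> s \<in> fst c} (snd c \<circ> \<alpha>))"

definition velocity :: "'m riem \<Rightarrow> (real \<Rightarrow> 'm) \<Rightarrow> real \<Rightarrow> 'm tvec"
  where "velocity M \<alpha> s =
    (\<lambda>c. if c \<in> charts_at M (\<alpha> s) then vector_derivative (snd c \<circ> \<alpha>) (at s) else 0)"

definition circle_embedding :: "'m::topological_space riem \<Rightarrow> real \<Rightarrow> (real \<Rightarrow> 'm) \<Rightarrow> bool"
  where "circle_embedding M L \<alpha> \<longleftrightarrow>
    L > 0 \<and> smooth_curve M \<alpha> \<and> (\<forall>s. velocity M \<alpha> s \<noteq> 0) \<and>
    (\<exists>f g. homeomorphism (sphere (0::complex) 1) (range \<alpha>) f g \<and>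
      (\<forall>s. \<alpha> s = f (cis (2 * pi * s / L))))"

definition arclength_parametrized :: "'m riem \<Rightarrow> (real \<Rightarrow> 'm) \<Rightarrow> bool"
  where "arclength_parametrized M \<alpha> \<longleftrightarrow> (\<forall>s. tnorm M (\<alpha> s) (velocity M \<alpha> s) = 1)"

definition smooth_field_along ::
    "'m riem \<Rightarrow> (real \<Rightarrow> 'm) \<Rightarrow> (real \<Rightarrow> 'm tvec) \<Rightarrow> bool"
  where "smooth_field_along M \<alpha> V \<longleftrightarrow>
    (\<forall>s. V s \<in> tangent_space M (\<alpha> s)) \<and>
    (\<forall>c\<in>Atlas M. smooth_on {s. \<alpha> s \<in> fst c} (\<lambda>s. V s c))"

text \<open>
  The covariant derivative along \<open>\<alpha>\<close> induced by \<open>nabla\<close>: for \<open>V = \<Sum>\<^sub>j V\<^sup>j \<partial>\<^sub>j\<close> in a chart,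
  \<open>D V = \<Sum>\<^sub>j (V\<^sup>j)' \<partial>\<^sub>j + V\<^sup>j \<nabla>\<^bsub>\<alpha>'\<^esub> \<partial>\<^sub>j\<close>.
\<close>

definition cov_deriv ::
    "'m riem \<Rightarrow> 'm conn \<Rightarrow> (real \<Rightarrow> 'm) \<Rightarrow> (real \<Rightarrow> 'm tvec) \<Rightarrow> real \<Rightarrow> 'm tvec"
  where "cov_deriv M nabla \<alpha> V s = (\<lambda>c. if c \<in> charts_at M (\<alpha> s) then
      vector_derivative (\<lambda>t. V t c) (at s)
      + (\<Sum>j\<in>UNIV. (V s c $ j) *\<^sub>R nabla (\<alpha> s) (velocity M \<alpha> s) (coord_field M c j) c)
    else 0)"


section \<open>The Frenet frame\<close>

definition frenet_T :: "'m riem \<Rightarrow> (real \<Rightarrow> 'm) \<Rightarrow> real \<Rightarrow> 'm tvec"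
  where "frenet_T M \<alpha> s = (1 / tnorm M (\<alpha> s) (velocity M \<alpha> s)) *\<^sub>R velocity M \<alpha> s"

definition normal_part :: "'m riem \<Rightarrow> (real \<Rightarrow> 'm) \<Rightarrow> real \<Rightarrow> 'm tvec \<Rightarrow> 'm tvec"
  where "normal_part M \<alpha> s X = X - Metric M (\<alpha> s) X (frenet_T M \<alpha> s) *\<^sub>R frenet_T M \<alpha> s"

text \<open>
  The second fundamental form \<open>\<Pi>(X, Y) = (\<nabla>\<^sub>X Z)\<^sup>\<bottom>\<close> of the image \<open>\<Sigma>\<close> of \<open>\<alpha>\<close> at
  \<open>\<alpha> s\<close>, for \<open>X\<close> and \<open>Y\<close> in the line spanned by \<open>\<alpha>'(s)\<close>. Here \<open>Z = f \<alpha>'\<close> is any tangential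
  field along \<open>\<Sigma>\<close> near \<open>\<alpha> s\<close> with \<open>Z s = Y\<close>, and \<open>\<nabla>\<^sub>X Z = a D Z\<close> if \<open>X = a \<alpha>'(s)\<close>.
\<close>

definition second_fundamental_form ::
    "'m riem \<Rightarrow> 'm conn \<Rightarrow> (real \<Rightarrow> 'm) \<Rightarrow> real \<Rightarrow> 'm tvec \<Rightarrow> 'm tvec \<Rightarrow> 'm tvec"
  where "second_fundamental_form M nabla \<alpha> s X Y =
    (THE W. \<forall>a f. smooth_on UNIV f \<and> X = a *\<^sub>R velocity M \<alpha> s \<and> Y = f s *\<^sub>R velocity M \<alpha> s \<longrightarrow>
      W = normal_part M \<alpha> s
            (a *\<^sub>R cov_deriv M nabla \<alpha> (\<lambda>t. f t *\<^sub>R velocity M \<alpha> t) s))"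

text \<open>The unit vector \<open>T\<close> is an orthonormal basis of the tangent line of \<open>\<Sigma>\<close>.\<close>

definition trace_second_fundamental_form ::
    "'m riem \<Rightarrow> 'm conn \<Rightarrow> (real \<Rightarrow> 'm) \<Rightarrow> real \<Rightarrow> 'm tvec"
  where "trace_second_fundamental_form M nabla \<alpha> s =
    second_fundamental_form M nabla \<alpha> s (frenet_T M \<alpha> s) (frenet_T M \<alpha> s)"

definition frenet_N :: "'m riem \<Rightarrow> 'm conn \<Rightarrow> (real \<Rightarrow> 'm) \<Rightarrow> real \<Rightarrow> 'm tvec"
  where "frenet_N M nabla \<alpha> s =
    (1 / tnorm M (\<alpha> s) (trace_second_fundamental_form M nabla \<alpha> s)) *\<^sub>R
      trace_second_fundamental_form M nabla \<alpha> s"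

definition frenet_B :: "'m riem \<Rightarrow> 'm conn \<Rightarrow> (real \<Rightarrow> 'm) \<Rightarrow> real \<Rightarrow> 'm tvec"
  where "frenet_B M nabla \<alpha> s =
    cross_product M (\<alpha> s) (frenet_T M \<alpha> s) (frenet_N M nabla \<alpha> s)"

definition curvature_and_torsion ::
    "'m riem \<Rightarrow> 'm conn \<Rightarrow> real \<Rightarrow> (real \<Rightarrow> 'm) \<Rightarrow> (real \<Rightarrow> real) \<Rightarrow> (real \<Rightarrow> real) \<Rightarrow> bool"
  where "curvature_and_torsion M nabla L \<alpha> \<kappa> \<tau> \<longleftrightarrow>
    smooth_on UNIV \<kappa> \<and> smooth_on UNIV \<tau> \<and>
    (\<forall>s. \<kappa> (s + L) = \<kappa> s \<and> \<tau> (s + L) = \<tau> s) \<and>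
    (\<forall>s. cov_deriv M nabla \<alpha> (frenet_T M \<alpha>) s = \<kappa> s *\<^sub>R frenet_N M nabla \<alpha> s \<and>
         cov_deriv M nabla \<alpha> (frenet_N M nabla \<alpha>) s =
           - \<kappa> s *\<^sub>R frenet_T M \<alpha> s + \<tau> s *\<^sub>R frenet_B M nabla \<alpha> s \<and>
         cov_deriv M nabla \<alpha> (frenet_B M nabla \<alpha>) s = - \<tau> s *\<^sub>R frenet_N M nabla \<alpha> s)"


section \<open>The bundle \<open>F\<close> and its connection form\<close>

text \<open>An element \<open>X + \<i> Y\<close> of the complexified tangent space is the pair \<open>(X, Y)\<close>.\<close>

type_synonym 'm ctvec = "'m tvec \<times> 'm tvec"

definition scaleC :: "complex \<Rightarrow> 'm ctvec \<Rightarrow> 'm ctvec"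
  where "scaleC z V =
    (Re z *\<^sub>R fst V - Im z *\<^sub>R snd V, Re z *\<^sub>R snd V + Im z *\<^sub>R fst V)"

definition hermitian_ext :: "'m riem \<Rightarrow> 'm \<Rightarrow> 'm ctvec \<Rightarrow> 'm ctvec \<Rightarrow> complex"
  where "hermitian_ext M p V W =
    Complex (Metric M p (fst V) (fst W) + Metric M p (snd V) (snd W))
            (Metric M p (snd V) (fst W) - Metric M p (fst V) (snd W))"

definition cov_deriv_ext ::
    "'m riem \<Rightarrow> 'm conn \<Rightarrow> (real \<Rightarrow> 'm) \<Rightarrow> (real \<Rightarrow> 'm ctvec) \<Rightarrow> real \<Rightarrow> 'm ctvec"
  where "cov_deriv_ext M nabla \<alpha> V s =
    (cov_deriv M nabla \<alpha> (\<lambda>t. fst (V t)) s, cov_deriv M nabla \<alpha> (\<lambda>t. snd (V t)) s)"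

definition fiber_F :: "'m riem \<Rightarrow> 'm conn \<Rightarrow> (real \<Rightarrow> 'm) \<Rightarrow> real \<Rightarrow> 'm ctvec set"
  where "fiber_F M nabla \<alpha> s =
    {scaleC a (frenet_T M \<alpha> s, 0) + scaleC b (frenet_N M nabla \<alpha> s, frenet_B M nabla \<alpha> s) |a b. True}"

definition proj_F :: "'m riem \<Rightarrow> 'm conn \<Rightarrow> (real \<Rightarrow> 'm) \<Rightarrow> real \<Rightarrow> 'm ctvec \<Rightarrow> 'm ctvec"
  where "proj_F M nabla \<alpha> s V =
    (THE W. W \<in> fiber_F M nabla \<alpha> s \<and>
      (\<forall>Z\<in>fiber_F M nabla \<alpha> s. hermitian_ext M (\<alpha> s) (V - W) Z = 0))"

definition nabla_F ::
    "'m riem \<Rightarrow> 'm conn \<Rightarrow> (real \<Rightarrow> 'm) \<Rightarrow> (real \<Rightarrow> 'm ctvec) \<Rightarrow> real \<Rightarrow> 'm ctvec"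
  where "nabla_F M nabla \<alpha> V s = proj_F M nabla \<alpha> s (cov_deriv_ext M nabla \<alpha> V s)"

text \<open>A smooth curve over \<open>\<alpha>\<close> in the bundle of unitary frames of \<open>F\<close>.\<close>

definition moving_frame_F ::
    "'m riem \<Rightarrow> 'm conn \<Rightarrow> (real \<Rightarrow> 'm) \<Rightarrow> (real \<Rightarrow> 2 \<Rightarrow> 'm ctvec) \<Rightarrow> bool"
  where "moving_frame_F M nabla \<alpha> A \<longleftrightarrow>
    (\<forall>s j. A s j \<in> fiber_F M nabla \<alpha> s) \<and>
    (\<forall>s i j. hermitian_ext M (\<alpha> s) (A s i) (A s j) = (if i = j then 1 else 0)) \<and>
    (\<forall>j. smooth_field_along M \<alpha> (\<lambda>s. fst (A s j)) \<and> smooth_field_along M \<alpha> (\<lambda>s. snd (A s j)))"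

text \<open>The connection form of \<open>F\<close> evaluated on the velocity at \<open>s\<close> of the curve \<open>A\<close> of frames.\<close>

definition theta_F ::
    "'m riem \<Rightarrow> 'm conn \<Rightarrow> (real \<Rightarrow> 'm) \<Rightarrow> (real \<Rightarrow> 2 \<Rightarrow> 'm ctvec) \<Rightarrow> real \<Rightarrow> complex^2^2"
  where "theta_F M nabla \<alpha> A s =
    (\<chi> i j. hermitian_ext M (\<alpha> s) (nabla_F M nabla \<alpha> (\<lambda>t. A t j) s) (A s i))"

definition u2 :: "(complex^2^2) set"
  where "u2 = {a. \<forall>i j. a $ i $ j = - cnj (a $ j $ i)}"

definition torsion_phase :: "(real \<Rightarrow> real) \<Rightarrow> real \<Rightarrow> complex"
  where "torsion_phase \<tau> s = exp (\<i> * of_real (LBINT x=0..s. \<tau> x))"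

definition hasimoto :: "(real \<Rightarrow> real) \<Rightarrow> (real \<Rightarrow> real) \<Rightarrow> real \<Rightarrow> complex"
  where "hasimoto \<kappa> \<tau> s = of_real (\<kappa> s) * torsion_phase \<tau> s"

definition frame_B ::
    "'m riem \<Rightarrow> 'm conn \<Rightarrow> (real \<Rightarrow> 'm) \<Rightarrow> (real \<Rightarrow> real) \<Rightarrow> real \<Rightarrow> 2 \<Rightarrow> 'm ctvec"
  where "frame_B M nabla \<alpha> \<tau> s j =
    (if j = 1 then (frenet_T M \<alpha> s, 0)
     else scaleC (torsion_phase \<tau> s / of_real (sqrt 2))
            (frenet_N M nabla \<alpha> s, frenet_B M nabla \<alpha> s))"

end

theory Submission
  imports Defs
begin

text \<open>
  The curvature and torsion equations give \<open>D (N + \<i> B) = - \<kappa> T - \<i> \<tau> (N + \<i> B)\<close>, so multiplying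
  \<open>N + \<i> B\<close> by the phase \<open>exp (\<i> \<integral>\<tau>)\<close> leaves a field whose derivative is a multiple of \<open>T\<close>. The
  projection onto \<open>F\<close> does not change pairings with vectors of \<open>F\<close>, and the entries of the connection
  form are inner products in the orthonormal frame \<open>T, N, B\<close>.

  The analytic content is that \<open>N\<close> and \<open>B\<close> are smooth tangent fields along \<open>\<alpha>\<close>. For \<open>N\<close>, the
  normalized normal part of \<open>D T\<close>, this needs the smoothness of the Christoffel symbols and the
  independence of \<open>D\<close> of the chart; for \<open>B\<close> it needs that the volume form does not depend on
  the chart, which is where the orientation enters.
\<close>

text \<open>The factor \<open>1 / sqrt 2\<close> has one source: \<open>N + \<i> B\<close> has
  squared Hermitian length 2, so its unit multiple carries this factor, which survives in both
  off-diagonal entries. The conjugate in the lower left entry comes from the conjugate linearity of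
  \<open>hermitian_ext\<close> in its second argument. The two diagonal entries vanish for different
  reasons: the derivative of \<open>T\<close> is a multiple of \<open>N\<close>, hence orthogonal to
  \<open>T\<close>, while the phase is chosen to remove the component of the other derivative along
  \<open>N + \<i> B\<close>. Most of the length is due to description operators.
  \<open>cross_product\<close>, \<open>second_fundamental_form\<close> and \<open>proj_F\<close> are
  given by \<open>THE\<close>, \<open>volume_form\<close> and \<open>dir_deriv\<close> rest on a
  chart picked by \<open>SOME\<close>; nothing can be computed from them before existence and
  uniqueness, or independence of the choice, is known. Over one period the phase changes by
  \<open>exp (\<i> * c)\<close> with c the total torsion, a factor that need not be 1. The frame is
  therefore treated as a curve over the parameter line.\<close>

section \<open>Smooth maps\<close>

lemma Ck_on_subset: "Ck_on k f S \<Longrightarrow> T \<subseteq> S \<Longrightarrow> Ck_on k f T"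
  by (induction k arbitrary: f) (auto intro: continuous_on_subset)

text \<open>\<open>frechet_derivative\<close> is a choice among all derivatives, and functions that
  agree near \<open>x\<close> have the same candidates. The equality thus holds even at points where
  neither is differentiable.\<close>

lemma frechet_derivative_cong_open:
  assumes "open S" "x \<in> S" "\<And>y. y \<in> S \<Longrightarrow> f y = g y"
  shows "frechet_derivative f (at x) = frechet_derivative g (at x)"
proof -
  have "(f has_derivative D) (at x) \<longleftrightarrow> (g has_derivative D) (at x)" for D
    using assms has_derivative_transform_within_open[of f D x UNIV S g]
      has_derivative_transform_within_open[of g D x UNIV S f] by auto
  then show ?thesis
    by (simp add: frechet_derivative_def)
qed

lemma Ck_on_cong:
  assumes "open S" "Ck_on k f S" "\<And>x. x \<in> S \<Longrightarrow> f x = g x"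
  shows "Ck_on k g S"
  using assms(2,3)
proof (induction k arbitrary: f g)
  case 0
  then show ?case
    by (auto cong: continuous_on_cong)
next
  case (Suc k)
  have "g differentiable (at x)" if "x \<in> S" for x
    using Suc.prems that assms(1)
      has_derivative_transform_within_open[of f _ x UNIV S g]
    by (fastforce simp: differentiable_def)
  moreover have "Ck_on k (\<lambda>x. frechet_derivative g (at x) v) S" for v
  proof (rule Suc.IH)
    show "Ck_on k (\<lambda>x. frechet_derivative f (at x) v) S"
      using Suc.prems by simp
    show "frechet_derivative f (at x) v = frechet_derivative g (at x) v" if "x \<in> S" for x
      using frechet_derivative_cong_open[OF assms(1) that] Suc.prems by metis
  qed
  ultimately show ?case
    by simp
qed

text \<open>Allows an explicit formula for the derivative in place of the chosen
  \<open>frechet_derivative\<close>. All closure rules below go through it.\<close>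

lemma Ck_on_SucI:
  assumes "open S" "\<And>x. x \<in> S \<Longrightarrow> (f has_derivative D x) (at x)"
    and "\<And>v. Ck_on k (\<lambda>x. D x v) S"
  shows "Ck_on (Suc k) f S"
proof -
  have "Ck_on k (\<lambda>x. frechet_derivative f (at x) v) S" for v
    using assms(1,3)
    by (rule Ck_on_cong) (simp add: frechet_derivative_at[OF assms(2), symmetric])
  then show ?thesis
    using assms(2) by (auto simp: differentiable_def)
qed

lemma Ck_on_Suc_imp: "Ck_on (Suc k) f S \<Longrightarrow> Ck_on k f S"
proof (induction k arbitrary: f)
  case 0
  then show ?case
    by (auto intro!: continuous_at_imp_continuous_on differentiable_imp_continuous_within)
qed auto

lemma Ck_on_has_derivative:
  "Ck_on (Suc k) f S \<Longrightarrow> x \<in> S \<Longrightarrow> (f has_derivative frechet_derivative f (at x)) (at x)"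
  by (simp add: frechet_derivative_works)

lemma Ck_on_const: "Ck_on k (\<lambda>x. c) S"
proof (induction k arbitrary: c)
  case (Suc k)
  have "frechet_derivative (\<lambda>x. c) (at x) = (\<lambda>v. 0)" for x :: 'a
    by (metis frechet_derivative_at has_derivative_const)
  with Suc show ?case
    by simp
qed simp

lemma Ck_on_linear:
  assumes "open S" "bounded_linear L" "Ck_on k f S"
  shows "Ck_on k (\<lambda>x. L (f x)) S"
  using assms(3)
proof (induction k arbitrary: f)
  case 0
  then show ?case
    using assms(2) by (simp add: bounded_linear.continuous_on)
next
  case (Suc k)
  show ?case
  proof (rule Ck_on_SucI[OF assms(1)])
    show "((\<lambda>x. L (f x)) has_derivative (\<lambda>v. L (frechet_derivative f (at x) v))) (at x)"
      if "x \<in> S" for x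
      by (rule bounded_linear.has_derivative[OF assms(2) Ck_on_has_derivative[OF Suc.prems that]])
  qed (use Suc in auto)
qed

lemma Ck_on_add:
  assumes "open S" "Ck_on k f S" "Ck_on k g S"
  shows "Ck_on k (\<lambda>x. f x + g x) S"
  using assms(2,3)
proof (induction k arbitrary: f g)
  case 0
  then show ?case
    by (auto intro: continuous_intros)
next
  case (Suc k)
  show ?case
  proof (rule Ck_on_SucI[OF assms(1)])
    show "((\<lambda>x. f x + g x) has_derivative
        (\<lambda>v. frechet_derivative f (at x) v + frechet_derivative g (at x) v)) (at x)" if "x \<in> S" for x
      by (rule has_derivative_add[OF Suc.prems[THEN Ck_on_has_derivative, OF that]])
  qed (use Suc in auto)
qed

lemma Ck_on_sum:
  assumes "open S" "\<And>i. i \<in> I \<Longrightarrow> Ck_on k (f i) S"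
  shows "Ck_on k (\<lambda>x. \<Sum>i\<in>I. f i x) S"
  using assms(2)
  by (induction I rule: infinite_finite_induct) (auto intro: Ck_on_const Ck_on_add assms(1))

text \<open>The product rule leaves one factor undifferentiated in each term. Hence the induction
  runs over all pairs \<open>f\<close>, \<open>g\<close> at once, and \<open>Ck_on_Suc_imp\<close>
  lowers the order of the untouched factor.\<close>

lemma Ck_on_bilinear:
  assumes "open S" "bounded_bilinear b" "Ck_on k f S" "Ck_on k g S"
  shows "Ck_on k (\<lambda>x. b (f x) (g x)) S"
  using assms(3,4)
proof (induction k arbitrary: f g)
  case 0
  then show ?case
    using bounded_bilinear.continuous_on[OF assms(2)] by simp
next
  case (Suc k)
  show ?case
  proof (rule Ck_on_SucI[OF assms(1)])
    show "((\<lambda>x. b (f x) (g x)) has_derivative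
        (\<lambda>v. b (f x) (frechet_derivative g (at x) v) + b (frechet_derivative f (at x) v) (g x))) (at x)"
      if "x \<in> S" for x
      by (rule bounded_bilinear.FDERIV[OF assms(2) Suc.prems[THEN Ck_on_has_derivative, OF that]])
    show "Ck_on k (\<lambda>x. b (f x) (frechet_derivative g (at x) v)
        + b (frechet_derivative f (at x) v) (g x)) S" for v
      using Suc.prems by (intro Ck_on_add assms(1) Suc.IH) (auto intro: Ck_on_Suc_imp)
  qed
qed

text \<open>In the chain rule the derivative of \<open>f\<close> is applied to a direction that
  varies with \<open>x\<close>, whereas the induction hypothesis only speaks of fixed directions.
  Expanding that direction in the finite basis of the middle space, as in \<open>D\<close>,
  separates the two; this is why that space is Euclidean.\<close>

lemma Ck_on_compose:
  fixes g :: "'a::real_normed_vector \<Rightarrow> 'b::euclidean_space"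
  assumes "open S" "open T" "Ck_on k g S" "Ck_on k f T" "g ` S \<subseteq> T"
  shows "Ck_on k (\<lambda>x. f (g x)) S"
  using assms(3,4)
proof (induction k arbitrary: f)
  case 0
  then show ?case
    using assms(5) continuous_on_compose2 by auto
next
  case (Suc k)
  define D where "D x v = (\<Sum>b\<in>Basis. (frechet_derivative g (at x) v \<bullet> b) *\<^sub>R
    frechet_derivative f (at (g x)) b)" for x v
  show ?case
  proof (rule Ck_on_SucI[OF assms(1)])
    fix x
    assume x: "x \<in> S"
    then have gx: "g x \<in> T"
      using assms(5) by auto
    have f: "(f has_derivative frechet_derivative f (at (g x))) (at (g x))"
      using Ck_on_has_derivative[OF Suc.prems(2) gx] .
    have "((\<lambda>x. f (g x)) has_derivative
        (\<lambda>v. frechet_derivative f (at (g x)) (frechet_derivative g (at x) v))) (at x)"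
      using diff_chain_at[OF Ck_on_has_derivative[OF Suc.prems(1) x] f] by (simp add: o_def)
    moreover have "frechet_derivative f (at (g x)) (frechet_derivative g (at x) v) = D x v" for v
    proof -
      define y where "y = frechet_derivative g (at x) v"
      interpret l: linear "frechet_derivative f (at (g x))"
        using f has_derivative_linear by blast
      show ?thesis
        unfolding D_def y_def[symmetric]
        by (subst (1) euclidean_representation[of y, symmetric]) (simp add: l.sum l.scale)
    qed
    ultimately show "((\<lambda>x. f (g x)) has_derivative D x) (at x)"
      by simp
  next
    fix v
    have "Ck_on k (\<lambda>x. frechet_derivative g (at x) v) S"
      using Suc.prems(1) by simp
    then have "Ck_on k (\<lambda>x. frechet_derivative g (at x) v \<bullet> b) S" for b
      using Ck_on_linear[OF assms(1) bounded_linear_inner_left] by auto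
    moreover have "Ck_on k (\<lambda>x. frechet_derivative f (at (g x)) b) S" for b
      using Suc.prems by (intro Suc.IH) (auto intro: Ck_on_Suc_imp)
    ultimately show "Ck_on k (\<lambda>x. D x v) S"
      unfolding D_def
      by (intro Ck_on_sum assms(1) Ck_on_bilinear[OF _ bounded_bilinear_scaleR])
  qed
qed

text \<open>Differentiation lowers the exponent by one, so the induction treats all real exponents
  together. Square roots and inverses are the exponents 1/2 and -1.\<close>

lemma Ck_on_powr:
  fixes f :: "'a::real_normed_vector \<Rightarrow> real"
  assumes "open S" "Ck_on k f S" "\<And>x. x \<in> S \<Longrightarrow> f x > 0"
  shows "Ck_on k (\<lambda>x. f x powr a) S"
  using assms(2)
proof (induction k arbitrary: a)
  case 0
  then show ?case
    using assms(3) by (auto intro!: continuous_intros simp: order_less_imp_not_eq2)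
next
  case (Suc k)
  show ?case
  proof (rule Ck_on_SucI[OF assms(1)])
    show "((\<lambda>x. f x powr a) has_derivative
        (\<lambda>v. frechet_derivative f (at x) v * (a * f x powr (a - 1)))) (at x)" if "x \<in> S" for x
    proof -
      have "((\<lambda>y. y powr a) has_real_derivative a * f x powr (a - 1)) (at (f x))"
        using assms(3)[OF that] by (rule has_real_derivative_powr)
      then show ?thesis
        using has_derivative_compose[OF Ck_on_has_derivative[OF Suc.prems that],
            of "\<lambda>y. y powr a" "(*) (a * f x powr (a - 1))"]
        by (simp add: has_field_derivative_def mult.commute)
    qed
    have "Ck_on k (\<lambda>x. frechet_derivative f (at x) v) S" for v
      using Suc.prems by simp
    moreover have "Ck_on k (\<lambda>x. f x powr (a - 1)) S"
      using Ck_on_Suc_imp Suc by blast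
    ultimately show "Ck_on k (\<lambda>x. frechet_derivative f (at x) v * (a * f x powr (a - 1))) S" for v
      by (intro Ck_on_bilinear[OF assms(1) bounded_bilinear_mult] Ck_on_const)
  qed
qed

section \<open>Smooth maps: passage to all orders, roots, inverses and determinants\<close>

lemma smooth_on_cong:
  "open S \<Longrightarrow> smooth_on S f \<Longrightarrow> (\<And>x. x \<in> S \<Longrightarrow> f x = g x) \<Longrightarrow> smooth_on S g"
  unfolding smooth_on_def using Ck_on_cong by blast

lemma smooth_on_subset: "smooth_on S f \<Longrightarrow> T \<subseteq> S \<Longrightarrow> smooth_on T f"
  unfolding smooth_on_def using Ck_on_subset by blast

lemma smooth_on_has_derivative:
  assumes "smooth_on S f" "x \<in> S"
  shows "(f has_derivative frechet_derivative f (at x)) (at x)"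
  using assms Ck_on_has_derivative unfolding smooth_on_def by blast

lemma smooth_on_frechet_derivative:
  assumes "smooth_on S f"
  shows "smooth_on S (\<lambda>x. frechet_derivative f (at x) v)"
proof -
  have "Ck_on (Suc k) f S" for k
    using assms smooth_on_def by blast
  then show ?thesis
    by (simp add: smooth_on_def)
qed

lemma smooth_on_const: "smooth_on S (\<lambda>x. c)"
  by (simp add: smooth_on_def Ck_on_const)

lemma smooth_on_linear:
  "open S \<Longrightarrow> bounded_linear L \<Longrightarrow> smooth_on S f \<Longrightarrow> smooth_on S (\<lambda>x. L (f x))"
  by (simp add: smooth_on_def Ck_on_linear)

lemma smooth_on_add:
  "open S \<Longrightarrow> smooth_on S f \<Longrightarrow> smooth_on S g \<Longrightarrow> smooth_on S (\<lambda>x. f x + g x)"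
  by (simp add: smooth_on_def Ck_on_add)

lemma smooth_on_sum:
  "open S \<Longrightarrow> (\<And>i. i \<in> I \<Longrightarrow> smooth_on S (f i)) \<Longrightarrow> smooth_on S (\<lambda>x. \<Sum>i\<in>I. f i x)"
  by (simp add: smooth_on_def Ck_on_sum)

lemma smooth_on_scaleR:
  "open S \<Longrightarrow> smooth_on S f \<Longrightarrow> smooth_on S g \<Longrightarrow> smooth_on S (\<lambda>x. f x *\<^sub>R g x)"
  by (simp add: smooth_on_def Ck_on_bilinear[OF _ bounded_bilinear_scaleR])

lemma smooth_on_mult:
  fixes f g :: "'a::real_normed_vector \<Rightarrow> 'b::real_normed_algebra"
  shows "open S \<Longrightarrow> smooth_on S f \<Longrightarrow> smooth_on S g \<Longrightarrow> smooth_on S (\<lambda>x. f x * g x)"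
  by (simp add: smooth_on_def Ck_on_bilinear[OF _ bounded_bilinear_mult])

lemma smooth_on_minus: "open S \<Longrightarrow> smooth_on S f \<Longrightarrow> smooth_on S (\<lambda>x. - f x)"
  by (rule smooth_on_linear[OF _ bounded_linear_minus[OF bounded_linear_ident]])

lemma smooth_on_diff:
  "open S \<Longrightarrow> smooth_on S f \<Longrightarrow> smooth_on S g \<Longrightarrow> smooth_on S (\<lambda>x. f x - g x)"
  using smooth_on_add[of S f "\<lambda>x. - g x"] by (simp add: smooth_on_minus)

lemma smooth_on_compose:
  fixes g :: "'a::real_normed_vector \<Rightarrow> 'b::euclidean_space"
  shows "open S \<Longrightarrow> open T \<Longrightarrow> smooth_on S g \<Longrightarrow> smooth_on T f \<Longrightarrow> g ` S \<subseteq> T \<Longrightarrow>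
    smooth_on S (\<lambda>x. f (g x))"
  by (simp add: smooth_on_def Ck_on_compose)

lemma smooth_on_powr:
  fixes f :: "'a::real_normed_vector \<Rightarrow> real"
  shows "open S \<Longrightarrow> smooth_on S f \<Longrightarrow> (\<And>x. x \<in> S \<Longrightarrow> f x > 0) \<Longrightarrow>
    smooth_on S (\<lambda>x. f x powr a)"
  by (simp add: smooth_on_def Ck_on_powr)

lemma smooth_on_sqrt:
  fixes f :: "'a::real_normed_vector \<Rightarrow> real"
  assumes "open S" "smooth_on S f" "\<And>x. x \<in> S \<Longrightarrow> f x > 0"
  shows "smooth_on S (\<lambda>x. sqrt (f x))"
  by (rule smooth_on_cong[OF assms(1) smooth_on_powr[OF assms, of "1/2"]])
    (use assms(3) in \<open>auto simp: powr_half_sqrt less_imp_le\<close>)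

lemma smooth_on_inverse:
  fixes f :: "'a::real_normed_vector \<Rightarrow> real"
  assumes "open S" "smooth_on S f" "\<And>x. x \<in> S \<Longrightarrow> f x > 0"
  shows "smooth_on S (\<lambda>x. inverse (f x))"
  by (rule smooth_on_cong[OF assms(1) smooth_on_powr[OF assms, of "-1"]])
    (use assms(3) in \<open>auto simp: powr_minus less_imp_le\<close>)

lemma smooth_on_nth:
  fixes f :: "'a::real_normed_vector \<Rightarrow> real^'n"
  shows "open S \<Longrightarrow> smooth_on S f \<Longrightarrow> smooth_on S (\<lambda>x. f x $ i)"
  by (rule smooth_on_linear[OF _ bounded_linear_vec_nth])

lemma smooth_on_vec:
  fixes f :: "'n::finite \<Rightarrow> 'a::real_normed_vector \<Rightarrow> real"
  assumes "open S" "\<And>i. smooth_on S (f i)"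
  shows "smooth_on S (\<lambda>x. \<chi> i. f i x)"
proof -
  have "(\<lambda>x. \<chi> i. f i x) = (\<lambda>x. \<Sum>i\<in>UNIV. f i x *\<^sub>R axis i 1)"
    using basis_expansion[of "\<chi> i. f i x" for x] by (simp add: scalar_mult_eq_scaleR)
  then show ?thesis
    by (simp only:) (intro smooth_on_sum smooth_on_scaleR smooth_on_const assms)
qed

lemma smooth_on_prod:
  fixes f :: "'i \<Rightarrow> 'a::real_normed_vector \<Rightarrow> real"
  assumes "open S" "\<And>i. i \<in> I \<Longrightarrow> smooth_on S (f i)"
  shows "smooth_on S (\<lambda>x. \<Prod>i\<in>I. f i x)"
  using assms(2)
  by (induction I rule: infinite_finite_induct)
    (auto intro: smooth_on_const smooth_on_mult assms(1))

lemma smooth_on_det: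
  fixes A :: "'a::real_normed_vector \<Rightarrow> real^'n^'n"
  assumes "open S" "\<And>i j. smooth_on S (\<lambda>x. A x $ i $ j)"
  shows "smooth_on S (\<lambda>x. det (A x))"
  unfolding det_def
  by (intro smooth_on_sum smooth_on_mult smooth_on_prod smooth_on_const assms)

lemma smooth_on_has_vector_derivative:
  assumes "smooth_on S f" "s \<in> S"
  shows "(f has_vector_derivative vector_derivative f (at s)) (at s)"
  using smooth_on_has_derivative[OF assms] differentiableI vector_derivative_works by blast

lemma smooth_on_vector_derivative:
  assumes "open S" "smooth_on S f"
  shows "smooth_on S (\<lambda>s. vector_derivative f (at s))"
proof (rule smooth_on_cong[OF assms(1) smooth_on_frechet_derivative[OF assms(2), of 1]])
  fix s
  assume "s \<in> S"
  from smooth_on_has_vector_derivative[OF assms(2) this]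
  show "frechet_derivative f (at s) 1 = vector_derivative f (at s)"
    by (simp add: has_vector_derivative_def frechet_derivative_at[symmetric])
qed

section \<open>Linear algebra in dimension three\<close>

lemma sum_fun_apply: "(\<Sum>i\<in>I. f i) x = (\<Sum>i\<in>I. f i x)"
  by (induction I rule: infinite_finite_induct) auto

lemma scaleR_fun_apply [simp]: "(a *\<^sub>R f) x = a *\<^sub>R f x"
  by (simp add: scaleR_fun_def)

lemma matrix_vector_mult_adjoint:
  fixes A :: "real^'n^'m"
  shows "(A *v x) \<bullet> y = x \<bullet> (transpose A *v y)"
  using dot_lmul_matrix[of x "transpose A" y] by simp

text \<open>The last column \<open>x\<close> of the adjugate satisfies \<open>A x = det A e\<^sub>3\<close>, and its last component is
  the leading minor of order two, so \<open>x \<bullet> A x > 0\<close> is the product of the two.\<close>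

lemma det_3_positive_definite:
  fixes A :: "real^3^3"
  assumes sym: "transpose A = A" and pos: "\<And>x. x \<noteq> 0 \<Longrightarrow> x \<bullet> (A *v x) > 0"
  shows "det A > 0"
proof -
  have s: "A $ i $ j = A $ j $ i" for i j
    using arg_cong[OF sym, of "\<lambda>B. B $ j $ i"] by (simp add: transpose_def)
  note expand = inner_vec_def matrix_vector_mult_def sum_3 vector_3
  have "A$1$1 > 0"
    using pos[of "vector [1,0,0]"] by (auto simp: expand vec_eq_iff forall_3)
  define m where "m = A$1$1 * A$2$2 - A$1$2 * A$1$2"
  \<comment> \<open>The test vector is the last column of the adjugate of the leading two-by-two
    block, the analogue one dimension lower of the \<open>x\<close> chosen below.\<close>
  have "A$1$1 * m > 0"
    using pos[of "vector [- (A$1$2), A$1$1, 0]"] \<open>A$1$1 > 0\<close>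
    by (simp add: expand vec_eq_iff forall_3 m_def s[of 2 1] algebra_simps)
  then have m: "m > 0"
    using \<open>A$1$1 > 0\<close> by (simp add: zero_less_mult_iff)
  define x :: "real^3" where
    "x = vector [A$1$2 * A$2$3 - A$1$3 * A$2$2, A$1$2 * A$1$3 - A$1$1 * A$2$3, m]"
  have "x \<noteq> 0"
    using m by (auto simp: x_def vec_eq_iff forall_3)
  moreover have "x \<bullet> (A *v x) = m * det A"
    by (simp add: expand x_def m_def det_3 s[of 2 1] s[of 3 1] s[of 3 2] algebra_simps)
  ultimately show ?thesis
    using pos[of x] m by (simp add: zero_less_mult_iff)
qed

lemma vector_3_eq: "(vector [u, v, w] :: 'a::zero^3) = (\<chi> i. if i = 1 then u else if i = 2 then v else w)"
  by (simp add: vec_eq_iff forall_3)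

lemma det_vector_3_mult:
  fixes A :: "real^3^3"
  shows "det (vector [A *v u, A *v v, A *v w] :: real^3^3) = det A * det (vector [u, v, w] :: real^3^3)"
proof -
  have "(vector [A *v u, A *v v, A *v w] :: real^3^3) = vector [u, v, w] ** transpose A"
    unfolding vector_3_eq
    by (simp add: vec_eq_iff matrix_matrix_mult_def matrix_vector_mult_def transpose_def
        mult.commute)
  then show ?thesis
    by (simp add: det_mul)
qed

text \<open>The Gram determinant: for the matrix \<open>P\<close> with rows \<open>u\<close>,
  \<open>v\<close>, \<open>w\<close>, the right-hand side is the determinant of
  \<open>P ** G ** transpose P\<close>. It turns a squared volume into inner products, from which
  the length of a cross product is found.\<close>

lemma det_vector_3_gram:
  fixes G :: "real^3^3" and u v w :: "real^3"
  assumes "\<And>i. a i = (if i = 1 then u else if i = 2 then v else w)"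
  shows "det G * (det (vector [u, v, w] :: real^3^3))\<^sup>2 = det ((\<chi> i j. a i \<bullet> (G *v a j)) :: real^3^3)"
proof -
  define P :: "real^3^3" where "P = vector [u, v, w]"
  have P: "P $ i = a i" for i
    unfolding P_def vector_3_eq by (simp add: assms)
  have "(P ** (G ** transpose P)) $ i $ j = a i \<bullet> (G *v a j)" for i j
    by (simp add: P[symmetric] matrix_matrix_mult_def matrix_vector_mult_def transpose_def
        inner_vec_def)
  then have "((\<chi> i j. a i \<bullet> (G *v a j)) :: real^3^3) = P ** (G ** transpose P)"
    by (simp add: vec_eq_iff)
  then show ?thesis
    by (simp add: det_mul P_def power2_eq_square)
qed

section \<open>Charts, tangent vectors and the metric\<close>

locale riemannian_3_manifold =
  fixes M :: "'m::{t2_space, second_countable_topology} riem"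
  assumes manifold: "oriented_riemannian_3_manifold M"
begin

definition gram :: "'m chart \<Rightarrow> 'm \<Rightarrow> real^3^3"
  where "gram c p = (\<chi> i j. Metric M p (coord_field M c i p) (coord_field M c j p))"

section \<open>Charts, transition maps and Jacobians\<close>

lemma charts_at_iff: "c \<in> charts_at M p \<longleftrightarrow> c \<in> Atlas M \<and> p \<in> fst c"
  by (simp add: charts_at_def)

lemma carrier_chart: "c \<in> charts_at M p \<Longrightarrow> p \<in> carrier_of M"
  by (auto simp: charts_at_iff carrier_of_def)

lemma open_chart: "c \<in> Atlas M \<Longrightarrow> open (fst c)"
  using manifold by (auto simp: oriented_riemannian_3_manifold_def oriented_atlas_def)

lemma chart_subset_carrier: "c \<in> Atlas M \<Longrightarrow> fst c \<subseteq> carrier_of M"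
  by (auto simp: carrier_of_def)

lemma chart_homeomorphism:
  "c \<in> Atlas M \<Longrightarrow> homeomorphism (fst c) (snd c ` fst c) (snd c) (cinv c)"
  using manifold by (simp add: oriented_riemannian_3_manifold_def oriented_atlas_def)

lemma cinv_chart [simp]: "c \<in> Atlas M \<Longrightarrow> p \<in> fst c \<Longrightarrow> cinv c (snd c p) = p"
  using chart_homeomorphism by (metis homeomorphism_apply1)

lemma open_chart_image:
  assumes "c \<in> Atlas M" "open U"
  shows "open (snd c ` (fst c \<inter> U))"
proof -
  have "openin (top_of_set (snd c ` fst c)) (snd c ` (fst c \<inter> U))"
    using homeomorphism_imp_open_map[OF chart_homeomorphism[OF assms(1)], of "fst c \<inter> U"] assms(2)
    by (simp add: openin_open_Int)
  moreover have "open (snd c ` fst c)"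
    using manifold assms(1) by (auto simp: oriented_riemannian_3_manifold_def oriented_atlas_def)
  ultimately show ?thesis
    using openin_open_eq by blast
qed

lemma smooth_transition:
  assumes "c \<in> Atlas M" "d \<in> Atlas M"
  shows "smooth_on (snd c ` (fst c \<inter> fst d)) (\<lambda>x. snd d (cinv c x))"
  using assms manifold
  by (auto simp: oriented_riemannian_3_manifold_def oriented_atlas_def o_def)

lemma jac_eq: "jac c d p = frechet_derivative (\<lambda>x. snd d (cinv c x)) (at (snd c p))"
  by (simp add: jac_def o_def)

lemma jac_has_derivative:
  assumes "c \<in> charts_at M p" "d \<in> charts_at M p"
  shows "((\<lambda>x. snd d (cinv c x)) has_derivative jac c d p) (at (snd c p))"
  unfolding jac_eq
  by (rule smooth_on_has_derivative[OF smooth_transition]) (use assms in \<open>auto simp: charts_at_iff\<close>)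

lemma jac_linear: "c \<in> charts_at M p \<Longrightarrow> d \<in> charts_at M p \<Longrightarrow> linear (jac c d p)"
  using jac_has_derivative has_derivative_linear by blast

text \<open>\<open>F\<close> and \<open>G\<close> are the expressions of one function on the
  manifold in the charts \<open>c\<close> and \<open>d\<close>, compared only near \<open>p\<close>;
  this is the chain rule through the transition map. With a third chart as the function it yields
  the cocycle rule \<open>jac_compose\<close>.\<close>

lemma derivative_change_chart:
  assumes c: "c \<in> charts_at M p" and d: "d \<in> charts_at M p" and "open U" "p \<in> U"
    and G: "(G has_derivative G') (at (snd d p))"
    and eq: "\<And>q. q \<in> fst c \<inter> fst d \<inter> U \<Longrightarrow> F (snd c q) = G (snd d q)"
  shows "(F has_derivative (\<lambda>x. G' (jac c d p x))) (at (snd c p))"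
proof (rule has_derivative_transform_within_open)
  show "((\<lambda>x. G (snd d (cinv c x))) has_derivative (\<lambda>x. G' (jac c d p x))) (at (snd c p))"
    by (rule has_derivative_compose[OF jac_has_derivative[OF c d]])
      (use c G in \<open>simp add: charts_at_iff\<close>)
  show "open (snd c ` (fst c \<inter> (fst d \<inter> U)))"
    using c d assms(3) by (auto intro!: open_chart_image open_chart simp: charts_at_iff)
  show "snd c p \<in> snd c ` (fst c \<inter> (fst d \<inter> U))"
    using c d assms(4) by (auto simp: charts_at_iff)
  show "G (snd d (cinv c x)) = F x" if "x \<in> snd c ` (fst c \<inter> (fst d \<inter> U))" for x
    using that eq c by (auto simp: charts_at_iff)
qed

lemma jac_compose:
  assumes "c \<in> charts_at M p" "d \<in> charts_at M p" "e \<in> charts_at M p"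
  shows "jac d e p (jac c d p x) = jac c e p x"
proof -
  have "((\<lambda>x. snd e (cinv c x)) has_derivative (\<lambda>x. jac d e p (jac c d p x))) (at (snd c p))"
    by (rule derivative_change_chart[OF assms(1,2) open_UNIV UNIV_I jac_has_derivative[OF assms(2,3)]])
      (use assms in \<open>auto simp: charts_at_iff\<close>)
  then show ?thesis
    using jac_has_derivative[OF assms(1,3)] has_derivative_unique by metis
qed

lemma jac_self:
  assumes "c \<in> charts_at M p"
  shows "jac c c p x = x"
proof -
  have "((\<lambda>x. snd c (cinv c x)) has_derivative (\<lambda>x. x)) (at (snd c p))"
  proof (rule has_derivative_transform_within_open[OF has_derivative_ident])
    show "open (snd c ` (fst c \<inter> UNIV))"
      using assms by (intro open_chart_image) (auto simp: charts_at_iff)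
  qed (use assms in \<open>auto simp: charts_at_iff\<close>)
  then show ?thesis
    using jac_has_derivative[OF assms assms] has_derivative_unique by metis
qed

lemma jac_matrix:
  "c \<in> charts_at M p \<Longrightarrow> d \<in> charts_at M p \<Longrightarrow> matrix (jac c d p) *v x = jac c d p x"
  by (simp add: jac_linear linear_matrix_vector_mul_eq matrix_works)

section \<open>Tangent spaces and their coordinate bases\<close>

lemma tangent_jac:
  "v \<in> tangent_space M p \<Longrightarrow> c \<in> charts_at M p \<Longrightarrow> d \<in> charts_at M p \<Longrightarrow> v d = jac c d p (v c)"
  unfolding tangent_space_def by blast

lemma tangent_off_chart: "v \<in> tangent_space M p \<Longrightarrow> c \<notin> charts_at M p \<Longrightarrow> v c = 0"
  unfolding tangent_space_def by blast

lemma tangent_spaceI: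
  assumes "\<And>c d. c \<in> charts_at M p \<Longrightarrow> d \<in> charts_at M p \<Longrightarrow> jac c d p (v c) = v d"
    and "\<And>d. d \<notin> charts_at M p \<Longrightarrow> v d = 0"
  shows "v \<in> tangent_space M p"
  unfolding tangent_space_def using assms by force

text \<open>By the cocycle rule, compatibility between arbitrary pairs of charts follows from
  compatibility with the single chart \<open>c\<close>.\<close>

lemma tangentI:
  assumes c: "c \<in> charts_at M p" "\<And>d. d \<in> charts_at M p \<Longrightarrow> jac c d p (v c) = v d"
    and "\<And>d. d \<notin> charts_at M p \<Longrightarrow> v d = 0"
  shows "v \<in> tangent_space M p"
proof (rule tangent_spaceI[OF _ assms(3)])
  fix d e
  assume "d \<in> charts_at M p" "e \<in> charts_at M p"
  then show "jac d e p (v d) = v e"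
    using jac_compose[OF c(1), of d e "v c"] by (simp add: c(2))
qed

lemma tangent_zero [simp]: "0 \<in> tangent_space M p"
  by (rule tangent_spaceI) (auto simp: linear_0 jac_linear)

lemma tangent_add [simp]:
  "u \<in> tangent_space M p \<Longrightarrow> v \<in> tangent_space M p \<Longrightarrow> u + v \<in> tangent_space M p"
  by (rule tangent_spaceI)
    (simp_all add: linear_add[OF jac_linear] tangent_jac[symmetric] tangent_off_chart)

lemma tangent_scaleR [simp]: "u \<in> tangent_space M p \<Longrightarrow> a *\<^sub>R u \<in> tangent_space M p"
  by (rule tangent_spaceI)
    (simp_all add: linear_scale[OF jac_linear] tangent_jac[symmetric] tangent_off_chart)

lemma tangent_minus [simp]: "u \<in> tangent_space M p \<Longrightarrow> - u \<in> tangent_space M p"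
  using tangent_scaleR[of u p "-1"] by simp

lemma tangent_diff [simp]:
  "u \<in> tangent_space M p \<Longrightarrow> v \<in> tangent_space M p \<Longrightarrow> u - v \<in> tangent_space M p"
  using tangent_add[of u p "- v"] by simp

lemma tangent_sum:
  "(\<And>i. i \<in> I \<Longrightarrow> f i \<in> tangent_space M p) \<Longrightarrow> (\<Sum>i\<in>I. f i) \<in> tangent_space M p"
  by (induction I rule: infinite_finite_induct) auto

lemma tangent_eqI:
  assumes "u \<in> tangent_space M p" "v \<in> tangent_space M p" "c \<in> charts_at M p" "u c = v c"
  shows "u = v"
proof
  fix d
  show "u d = v d"
    using assms tangent_jac[of u p c d] tangent_jac[of v p c d]
      tangent_off_chart[of u p d] tangent_off_chart[of v p d]
    by (cases "d \<in> charts_at M p") auto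
qed

lemma coord_field_tangent [simp]:
  assumes "c \<in> charts_at M p"
  shows "coord_field M c j p \<in> tangent_space M p"
  by (rule tangentI[OF assms]) (use assms in \<open>auto simp: coord_field_def jac_self\<close>)

lemma coord_field_same [simp]: "c \<in> charts_at M p \<Longrightarrow> coord_field M c j p c = axis j 1"
  by (simp add: coord_field_def jac_self)

lemma tangent_expansion:
  assumes "v \<in> tangent_space M p" "c \<in> charts_at M p"
  shows "v = (\<Sum>j\<in>UNIV. (v c $ j) *\<^sub>R coord_field M c j p)"
proof (rule tangent_eqI[OF assms(1) _ assms(2)])
  show "(\<Sum>j\<in>UNIV. (v c $ j) *\<^sub>R coord_field M c j p) \<in> tangent_space M p"
    by (intro tangent_sum) (simp add: assms(2))
  show "v c = (\<Sum>j\<in>UNIV. (v c $ j) *\<^sub>R coord_field M c j p) c"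
    using assms(2) basis_expansion[of "v c"] by (simp add: sum_fun_apply scalar_mult_eq_scaleR)
qed

lemma tangent_exists:
  assumes "c \<in> charts_at M p"
  obtains v where "v \<in> tangent_space M p" "v c = x"
proof
  show "(\<Sum>j\<in>UNIV. (x $ j) *\<^sub>R coord_field M c j p) \<in> tangent_space M p"
    by (intro tangent_sum) (simp add: assms)
  show "(\<Sum>j\<in>UNIV. (x $ j) *\<^sub>R coord_field M c j p) c = x"
    using assms basis_expansion[of x] by (simp add: sum_fun_apply scalar_mult_eq_scaleR)
qed

section \<open>The metric as a bilinear form and its Gram matrices\<close>

lemma metric_sym:
  "p \<in> carrier_of M \<Longrightarrow> u \<in> tangent_space M p \<Longrightarrow> v \<in> tangent_space M p \<Longrightarrow>
    Metric M p u v = Metric M p v u"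
  using manifold unfolding oriented_riemannian_3_manifold_def riemannian_metric_def by blast

lemma metric_add_left [simp]:
  "p \<in> carrier_of M \<Longrightarrow> u \<in> tangent_space M p \<Longrightarrow> v \<in> tangent_space M p \<Longrightarrow>
    w \<in> tangent_space M p \<Longrightarrow> Metric M p (u + v) w = Metric M p u w + Metric M p v w"
  using manifold unfolding oriented_riemannian_3_manifold_def riemannian_metric_def by blast

lemma metric_scaleR_left [simp]:
  "p \<in> carrier_of M \<Longrightarrow> u \<in> tangent_space M p \<Longrightarrow> v \<in> tangent_space M p \<Longrightarrow>
    Metric M p (a *\<^sub>R u) v = a * Metric M p u v"
  using manifold unfolding oriented_riemannian_3_manifold_def riemannian_metric_def by blast

lemma metric_pos:
  "p \<in> carrier_of M \<Longrightarrow> u \<in> tangent_space M p \<Longrightarrow> u \<noteq> 0 \<Longrightarrow> Metric M p u u > 0"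
  using manifold unfolding oriented_riemannian_3_manifold_def riemannian_metric_def by blast

lemma metric_add_right [simp]:
  "p \<in> carrier_of M \<Longrightarrow> u \<in> tangent_space M p \<Longrightarrow> v \<in> tangent_space M p \<Longrightarrow>
    w \<in> tangent_space M p \<Longrightarrow> Metric M p w (u + v) = Metric M p w u + Metric M p w v"
  using metric_sym[of p w] by simp

lemma metric_scaleR_right [simp]:
  "p \<in> carrier_of M \<Longrightarrow> u \<in> tangent_space M p \<Longrightarrow> v \<in> tangent_space M p \<Longrightarrow>
    Metric M p v (a *\<^sub>R u) = a * Metric M p v u"
  using metric_sym[of p v] by simp

lemma metric_zero_left [simp]:
  "p \<in> carrier_of M \<Longrightarrow> u \<in> tangent_space M p \<Longrightarrow> Metric M p 0 u = 0"
  using metric_scaleR_left[of p 0 u 0] by simp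

lemma metric_zero_right [simp]:
  "p \<in> carrier_of M \<Longrightarrow> u \<in> tangent_space M p \<Longrightarrow> Metric M p u 0 = 0"
  using metric_sym[of p u 0] by simp

lemma metric_minus_left [simp]:
  "p \<in> carrier_of M \<Longrightarrow> u \<in> tangent_space M p \<Longrightarrow> v \<in> tangent_space M p \<Longrightarrow>
    Metric M p (- u) v = - Metric M p u v"
  using metric_scaleR_left[of p u v "-1"] by simp

lemma metric_minus_right [simp]:
  "p \<in> carrier_of M \<Longrightarrow> u \<in> tangent_space M p \<Longrightarrow> v \<in> tangent_space M p \<Longrightarrow>
    Metric M p v (- u) = - Metric M p v u"
  using metric_scaleR_right[of p u v "-1"] by simp

lemma metric_diff_left [simp]:
  "p \<in> carrier_of M \<Longrightarrow> u \<in> tangent_space M p \<Longrightarrow> v \<in> tangent_space M p \<Longrightarrow>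
    w \<in> tangent_space M p \<Longrightarrow> Metric M p (u - v) w = Metric M p u w - Metric M p v w"
  using metric_add_left[of p u "- v" w] by simp

lemma metric_diff_right [simp]:
  "p \<in> carrier_of M \<Longrightarrow> u \<in> tangent_space M p \<Longrightarrow> v \<in> tangent_space M p \<Longrightarrow>
    w \<in> tangent_space M p \<Longrightarrow> Metric M p w (u - v) = Metric M p w u - Metric M p w v"
  using metric_add_right[of p u "- v" w] by simp

lemma metric_eq_zero_iff:
  "p \<in> carrier_of M \<Longrightarrow> u \<in> tangent_space M p \<Longrightarrow> Metric M p u u = 0 \<longleftrightarrow> u = 0"
  using metric_pos[of p u] by fastforce

lemma metric_chart:
  assumes c: "c \<in> charts_at M p" and u: "u \<in> tangent_space M p" and v: "v \<in> tangent_space M p"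
  shows "Metric M p u v = u c \<bullet> (gram c p *v v c)"
proof -
  note [simp] = carrier_chart[OF c] c
  have "Metric M p u v = Metric M p (\<Sum>i\<in>UNIV. (u c $ i) *\<^sub>R coord_field M c i p)
      (\<Sum>j\<in>UNIV. (v c $ j) *\<^sub>R coord_field M c j p)"
    using tangent_expansion[OF u c] tangent_expansion[OF v c] by simp
  also have "\<dots> = u c \<bullet> (gram c p *v v c)"
    by (simp add: sum_3 inner_vec_def matrix_vector_mult_def gram_def algebra_simps)
  finally show ?thesis .
qed

lemma gram_symmetric: "c \<in> charts_at M p \<Longrightarrow> transpose (gram c p) = gram c p"
  using metric_sym[OF carrier_chart]
  by (simp add: transpose_def gram_def vec_eq_iff)

lemma gram_pos:
  assumes c: "c \<in> charts_at M p" and "x \<noteq> 0"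
  shows "x \<bullet> (gram c p *v x) > 0"
proof -
  obtain v where v: "v \<in> tangent_space M p" "v c = x"
    using tangent_exists[OF c] .
  then have "v \<noteq> 0"
    using assms(2) by auto
  then show ?thesis
    using metric_pos[OF carrier_chart[OF c] v(1)] metric_chart[OF c v(1) v(1)] v(2) by simp
qed

lemma det_gram_pos: "c \<in> charts_at M p \<Longrightarrow> det (gram c p) > 0"
  by (rule det_3_positive_definite[OF gram_symmetric gram_pos])

lemma smooth_gram:
  assumes "c \<in> Atlas M"
  shows "smooth_on (snd c ` fst c) (\<lambda>x. gram c (cinv c x) $ i $ j)"
proof -
  have "riemannian_metric M (Metric M)"
    using manifold by (simp add: oriented_riemannian_3_manifold_def)
  then have "smooth_function_on M (fst c) (\<lambda>p. Metric M p (coord_field M c i p) (coord_field M c j p))"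
    using assms unfolding riemannian_metric_def by simp
  then have "smooth_on (snd c ` (fst c \<inter> fst c))
      ((\<lambda>p. Metric M p (coord_field M c i p) (coord_field M c j p)) \<circ> cinv c)"
    using assms unfolding smooth_function_on_def by blast
  then show ?thesis
    by (simp add: gram_def o_def)
qed

section \<open>The volume form and the cross product\<close>

lemma det_gram_change:
  assumes c: "c \<in> charts_at M p" and d: "d \<in> charts_at M p"
  shows "det (gram c p) = (det (matrix (jac c d p)))\<^sup>2 * det (gram d p)"
proof -
  let ?J = "matrix (jac c d p)"
  have J: "coord_field M c j p d = ?J *v axis j 1" for j
    using d by (simp add: coord_field_def jac_matrix[OF c d])
  have "gram c p $ i $ j = (transpose ?J ** (gram d p ** ?J)) $ i $ j" for i j
  proof -
    have "gram c p $ i $ j = (?J *v axis i 1) \<bullet> (gram d p *v (?J *v axis j 1))"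
      using metric_chart[OF d coord_field_tangent[OF c, of i] coord_field_tangent[OF c, of j]]
      by (simp add: gram_def J)
    also have "\<dots> = axis i 1 \<bullet> ((transpose ?J ** (gram d p ** ?J)) *v axis j 1)"
      by (simp only: matrix_vector_mult_adjoint matrix_vector_mul_assoc)
    finally show ?thesis
      by (simp add: matrix_vector_mult_basis column_def inner_axis' )
  qed
  then have "gram c p = transpose ?J ** (gram d p ** ?J)"
    by (simp add: vec_eq_iff)
  then show ?thesis
    by (simp add: det_mul power2_eq_square)
qed

lemma volume_form_chart:
  assumes c: "c \<in> charts_at M p"
    and uvw: "u \<in> tangent_space M p" "v \<in> tangent_space M p" "w \<in> tangent_space M p"
  shows "volume_form M p u v w =
    sqrt (det (gram c p)) * det (vector [u c, v c, w c] :: real^3^3)"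
proof -
  define d where "d = (SOME c. c \<in> charts_at M p)"
  have d: "d \<in> charts_at M p"
    unfolding d_def using c by (rule someI)
  let ?J = "matrix (jac d c p)"
  have J: "x c = ?J *v (x d)" if "x \<in> tangent_space M p" for x
    using tangent_jac[OF that d c] jac_matrix[OF d c] by simp
  have "det ?J > 0"
    using manifold c d unfolding oriented_riemannian_3_manifold_def oriented_atlas_def
    by (auto simp: charts_at_iff)
  \<comment> \<open>The Gram determinants differ by the square of \<open>det ?J\<close>, whose root
    is its absolute value. Positivity removes the absolute value, and the factor then matches the
    one produced by the determinant of the components.\<close>
  then have "sqrt (det (gram d p)) = det ?J * sqrt (det (gram c p))"
    by (simp add: det_gram_change[OF d c] real_sqrt_mult)
  then have "sqrt (det (gram d p)) * det (vector [u d, v d, w d] :: real^3^3) =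
      sqrt (det (gram c p)) * det (vector [u c, v c, w c] :: real^3^3)"
    by (simp add: J uvw det_vector_3_mult)
  then show ?thesis
    by (simp add: volume_form_def d_def gram_def Let_def)
qed

text \<open>The components of \<open>u \<times> v\<close> in a chart, from solving \<open>g x = \<surd>(det g) (u \<times> v)\<close> with
  Cramer's rule, where \<open>\<times>\<close> on the right is the cross product of \<open>\<real>\<^sup>3\<close>.\<close>

definition cross_components :: "real^3^3 \<Rightarrow> real^3 \<Rightarrow> real^3 \<Rightarrow> real^3"
  where "cross_components g u v = (\<chi> k.
    det ((\<chi> i j. if j = k then sqrt (det g) * cross3 u v $ i else g $ i $ j) :: real^3^3) / det g)"

text \<open>A tangent vector with the components from Cramer's rule pairs with \<open>w\<close> to
  the scalar triple product, that is, to the volume form. Any other solution differs from it by a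
  vector orthogonal to everything, in particular to itself. The component formula is kept because
  smoothness is read off from it.\<close>

lemma cross_product_unique:
  assumes c: "c \<in> charts_at M p" and u: "u \<in> tangent_space M p" and v: "v \<in> tangent_space M p"
  shows "cross_product M p u v \<in> tangent_space M p" (is ?A)
    and "w \<in> tangent_space M p \<Longrightarrow>
      Metric M p (cross_product M p u v) w = volume_form M p u v w" (is "_ \<Longrightarrow> ?B w")
    and "cross_product M p u v c = cross_components (gram c p) (u c) (v c)" (is ?C)
proof -
  define x where "x = cross_components (gram c p) (u c) (v c)"
  obtain X where X: "X \<in> tangent_space M p" "X c = x"
    using tangent_exists[OF c] .
  have x: "gram c p *v x = sqrt (det (gram c p)) *\<^sub>R cross3 (u c) (v c)"
    by (subst cramer) (use det_gram_pos[OF c] in \<open>auto simp: x_def cross_components_def cong: if_cong\<close>)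
  have Xw: "Metric M p X w = volume_form M p u v w" if w: "w \<in> tangent_space M p" for w
  proof -
    have "Metric M p X w = (gram c p *v x) \<bullet> w c"
      using metric_chart[OF c X(1) w] X(2) gram_symmetric[OF c]
        matrix_vector_mult_adjoint[of "gram c p" x "w c"]
      by simp
    also have "\<dots> = sqrt (det (gram c p)) * (w c \<bullet> cross3 (u c) (v c))"
      by (simp add: x inner_commute)
    also have "w c \<bullet> cross3 (u c) (v c) = det (vector [u c, v c, w c] :: real^3^3)"
      by (simp add: dot_cross_det det_3)
    finally show ?thesis
      using volume_form_chart[OF c u v w] by simp
  qed
  have "cross_product M p u v = X"
    unfolding cross_product_def
  proof (rule the_equality)
    fix Y
    assume Y: "Y \<in> tangent_space M p \<and>
      (\<forall>w\<in>tangent_space M p. Metric M p Y w = volume_form M p u v w)"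
    then have "Metric M p (Y - X) (Y - X) = 0"
      using X(1) Xw carrier_chart[OF c] by (subst metric_diff_left) auto
    then show "Y = X"
      using Y X(1) carrier_chart[OF c] by (subst (asm) metric_eq_zero_iff) auto
  qed (use X Xw in auto)
  then show ?A "w \<in> tangent_space M p \<Longrightarrow> ?B w" ?C
    using X Xw x_def by auto
qed

text \<open>Orthogonality comes from determinants with a repeated row. For the length, let
  \<open>n\<close> be the squared norm of \<open>x\<close>. It equals the volume of
  \<open>u\<close>, \<open>v\<close>, \<open>x\<close>, whose square is the Gram determinant, here
  of the diagonal matrix with entries 1, 1, \<open>n\<close>. Hence \<open>n\<^sup>2 = n\<close>,
  and only \<open>n = 0\<close> must be excluded.\<close>

lemma cross_product_orthonormal:
  assumes c: "c \<in> charts_at M p" and u: "u \<in> tangent_space M p" and v: "v \<in> tangent_space M p"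
    and uu: "Metric M p u u = 1" and vv: "Metric M p v v = 1" and uv: "Metric M p u v = 0"
  defines "x \<equiv> cross_product M p u v"
  shows "Metric M p x u = 0" "Metric M p x v = 0" "Metric M p x x = 1"
proof -
  note p = carrier_chart[OF c]
  have x: "x \<in> tangent_space M p" "\<And>w. w \<in> tangent_space M p \<Longrightarrow> Metric M p x w = volume_form M p u v w"
    using cross_product_unique(1,2)[OF c u v] by (auto simp: x_def)
  show xu: "Metric M p x u = 0" and xv: "Metric M p x v = 0"
    using x u v by (simp_all add: volume_form_chart[OF c] det_3)
  define n where "n = Metric M p x x"
  define D where "D = det (vector [u c, v c, x c] :: real^3^3)"
  have "n\<^sup>2 = det (gram c p) * D\<^sup>2"
    using det_gram_pos[OF c] x
    by (simp add: n_def D_def volume_form_chart[OF c u v x(1)] power_mult_distrib)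
  also have "\<dots> = det ((\<chi> i j. (if i = 1 then u c else if i = 2 then v c else x c) \<bullet>
      (gram c p *v (if j = 1 then u c else if j = 2 then v c else x c))) :: real^3^3)"
    unfolding D_def by (rule det_vector_3_gram) simp
  also have "\<dots> = n"
    using u v x uu vv uv xu xv metric_sym[OF p, of x u] metric_sym[OF p, of x v] metric_sym[OF p u v]
    by (simp add: det_3 metric_chart[OF c, symmetric] n_def)
  finally have "n = 0 \<or> n = 1"
    by (simp add: power2_eq_square)
  moreover have "n \<noteq> 0"
  proof
    assume "n = 0"
    then have "x = 0"
      using metric_eq_zero_iff[OF p x(1)] n_def by simp
    \<comment> \<open>If \<open>x = 0\<close>, every volume with \<open>u\<close> and
      \<open>v\<close> vanishes. For this \<open>w\<close> the determinant of the components is the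
      squared Euclidean length of \<open>cross3 (u c) (v c)\<close>, so \<open>u\<close> and
      \<open>v\<close> would be parallel.\<close>
    obtain w where w: "w \<in> tangent_space M p" "w c = cross3 (u c) (v c)"
      using tangent_exists[OF c] .
    have "w c \<bullet> cross3 (u c) (v c) = det (vector [u c, v c, w c] :: real^3^3)"
      by (simp add: dot_cross_det det_3)
    also have "\<dots> = 0"
      using x(2)[OF w(1)] \<open>x = 0\<close> w(1) p det_gram_pos[OF c] by (simp add: volume_form_chart[OF c u v])
    finally have "collinear {0, u c, v c}"
      using w(2) by (simp add: cross_eq_0[symmetric])
    moreover have "u c \<noteq> 0" "v c \<noteq> 0"
      using uu vv metric_chart[OF c u u] metric_chart[OF c v v] by auto
    ultimately obtain k where "v c = k *\<^sub>R u c"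
      by (auto simp: collinear_lemma)
    then have "v = k *\<^sub>R u"
      using u v by (intro tangent_eqI[OF _ _ c]) auto
    then show False
      using uu vv uv u p by simp
  qed
  ultimately show "Metric M p x x = 1"
    by (simp add: n_def)
qed

end

section \<open>Connections and covariant derivatives along curves\<close>

context riemannian_3_manifold
begin

section \<open>Smooth fields and directional derivatives under changes of chart\<close>

lemma jac_smooth:
  assumes "c \<in> Atlas M" "d \<in> Atlas M"
  shows "smooth_on (snd c ` (fst c \<inter> fst d))
    (\<lambda>x. frechet_derivative (\<lambda>x. snd d (cinv c x)) (at x) v)"
  by (rule smooth_on_frechet_derivative[OF smooth_transition[OF assms]])

text \<open>Smoothness on the manifold is demanded in every chart. Since transition maps are smooth,
  one smooth expression \<open>G\<close> in a chart containing \<open>U\<close> suffices.\<close>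

lemma smooth_on_change_chart:
  assumes c: "c \<in> Atlas M" and d: "d \<in> Atlas M" and U: "open U" "U \<subseteq> fst c"
    and G: "smooth_on (snd c ` U) G"
    and eq: "\<And>q. q \<in> fst d \<inter> U \<Longrightarrow> F q = G (snd c q)"
  shows "smooth_on (snd d ` (fst d \<inter> U)) (\<lambda>x. F (cinv d x))"
proof (rule smooth_on_cong)
  show "open (snd d ` (fst d \<inter> U))"
    by (rule open_chart_image[OF d U(1)])
  then show "smooth_on (snd d ` (fst d \<inter> U)) (\<lambda>x. G (snd c (cinv d x)))"
  proof (rule smooth_on_compose)
    show "open (snd c ` U)"
      using open_chart_image[OF c U(1)] U(2) by (simp add: Int_absorb1)
    show "smooth_on (snd d ` (fst d \<inter> U)) (\<lambda>x. snd c (cinv d x))"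
      by (rule smooth_on_subset[OF smooth_transition[OF d c]]) (use U in auto)
    show "(\<lambda>x. snd c (cinv d x)) ` snd d ` (fst d \<inter> U) \<subseteq> snd c ` U"
      using d by auto
  qed (rule G)
qed (use d eq in auto)

lemma smooth_coord_field:
  assumes c: "c \<in> Atlas M" and U: "open U" "U \<subseteq> fst c"
  shows "smooth_field_on M U (coord_field M c j)"
  unfolding smooth_field_on_def
proof (intro conjI ballI)
  show "coord_field M c j p \<in> tangent_space M p" if "p \<in> U" for p
    using that c U by (intro coord_field_tangent) (auto simp: charts_at_iff)
  fix d
  assume d: "d \<in> Atlas M"
  \<comment> \<open>The set is shrunk to \<open>fst d \<inter> U\<close> because the Jacobian that
    gives the components in \<open>d\<close> is smooth only where both charts are defined.\<close>
  have *: "smooth_on (snd d ` (fst d \<inter> (fst d \<inter> U))) (\<lambda>x. coord_field M c j (cinv d x) d)"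
  proof (rule smooth_on_change_chart[OF c d, where F = "\<lambda>q. coord_field M c j q d"])
    show "smooth_on (snd c ` (fst d \<inter> U))
        (\<lambda>x. frechet_derivative (\<lambda>x. snd d (cinv c x)) (at x) (axis j 1))"
      by (rule smooth_on_subset[OF jac_smooth[OF c d]]) (use U in auto)
    show "open (fst d \<inter> U)"
      using open_chart[OF d] U by auto
  qed (use d U in \<open>auto simp: coord_field_def charts_at_iff jac_eq\<close>)
  then show "smooth_on (snd d ` (fst d \<inter> U)) (\<lambda>x. coord_field M c j (cinv d x) d)"
    by simp
qed

lemma smooth_field_on_add:
  assumes "open U" "smooth_field_on M U Y" "smooth_field_on M U Z"
  shows "smooth_field_on M U (\<lambda>q. Y q + Z q)"
  using assms by (auto simp: smooth_field_on_def intro!: smooth_on_add open_chart_image)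

lemma smooth_field_on_scaleR:
  assumes "open U" "smooth_function_on M U f" "smooth_field_on M U Y"
  shows "smooth_field_on M U (\<lambda>q. f q *\<^sub>R Y q)"
  using assms
  by (auto simp: smooth_field_on_def smooth_function_on_def o_def
      intro!: smooth_on_scaleR open_chart_image)

text \<open>Replaces the chart picked by \<open>SOME\<close> with any convenient one: the Jacobian
  from the chain rule is absorbed by the transformation of \<open>v\<close>.\<close>

lemma dir_deriv_chart:
  assumes c: "c \<in> charts_at M p" and v: "v \<in> tangent_space M p" and U: "open U" "p \<in> U"
    and G: "(G has_derivative G') (at (snd c p))"
    and eq: "\<And>q. q \<in> fst c \<inter> U \<Longrightarrow> f q = G (snd c q)"
  shows "dir_deriv M p v f = G' (v c)"
proof -
  define e where "e = (SOME c. c \<in> charts_at M p)"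
  have e: "e \<in> charts_at M p"
    unfolding e_def using c by (rule someI)
  have "((\<lambda>x. f (cinv e x)) has_derivative (\<lambda>x. G' (jac e c p x))) (at (snd e p))"
    by (rule derivative_change_chart[OF e c U G]) (use e eq in \<open>auto simp: charts_at_iff\<close>)
  then show ?thesis
    using tangent_jac[OF v e c]
    by (simp add: dir_deriv_def e_def[symmetric] o_def frechet_derivative_at[symmetric])
qed

end

locale curve_in_3_manifold = riemannian_3_manifold M
  for M :: "'m::{t2_space, second_countable_topology} riem" +
  fixes nabla :: "'m conn" and \<alpha> :: "real \<Rightarrow> 'm"
  assumes nabla: "affine_connection M nabla" and curve: "smooth_curve M \<alpha>"
begin

abbreviation D where "D \<equiv> cov_deriv M nabla \<alpha>"

abbreviation dom where "dom c \<equiv> {s. \<alpha> s \<in> fst c}"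

section \<open>The connection on coordinate fields: Christoffel symbols and their
  transformation\<close>

context
  fixes U Y p v
  assumes U: "open U" "U \<subseteq> carrier_of M" and Y: "smooth_field_on M U Y" and p: "p \<in> U"
    and v: "v \<in> tangent_space M p"
begin

lemmas nabla_rules = bspec[OF bspec[OF conjunct1[OF mp[OF spec[OF mp[OF spec[OF
  nabla[unfolded affine_connection_def]] conjI[OF U]], of Y] Y]] p] v]

lemma nabla_tangent: "nabla p v Y \<in> tangent_space M p"
  by (rule nabla_rules[THEN conjunct1])

lemma nabla_add_direction:
  "w \<in> tangent_space M p \<Longrightarrow> nabla p (v + w) Y = nabla p v Y + nabla p w Y"
  by (rule nabla_rules[THEN conjunct2, THEN conjunct1, THEN bspec])

lemma nabla_scaleR_direction: "nabla p (a *\<^sub>R v) Y = a *\<^sub>R nabla p v Y"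
  by (rule nabla_rules[THEN conjunct2, THEN conjunct2, THEN conjunct1, THEN spec])

lemma nabla_add:
  "smooth_field_on M U Z \<Longrightarrow> nabla p v (\<lambda>q. Y q + Z q) = nabla p v Y + nabla p v Z"
  by (rule nabla_rules[THEN conjunct2, THEN conjunct2, THEN conjunct2, THEN conjunct1,
        THEN spec, THEN mp])

lemma nabla_scaleR:
  "smooth_function_on M U f \<Longrightarrow>
    nabla p v (\<lambda>q. f q *\<^sub>R Y q) = dir_deriv M p v f *\<^sub>R Y p + f p *\<^sub>R nabla p v Y"
  by (rule nabla_rules[THEN conjunct2, THEN conjunct2, THEN conjunct2, THEN conjunct2,
        THEN conjunct1, THEN spec, THEN mp])

lemma nabla_cong: "(\<And>q. q \<in> U \<Longrightarrow> Z q = Y q) \<Longrightarrow> nabla p v Z = nabla p v Y"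
  by (rule nabla_rules[THEN conjunct2, THEN conjunct2, THEN conjunct2, THEN conjunct2,
        THEN conjunct2, THEN spec, THEN mp]) simp

end

text \<open>The smoothness clause of \<open>affine_connection\<close> needs directions given by a
  field on an open set, while the velocity lives only along the curve. Linearity in the direction
  reduces to the coordinate directions, which are such fields.\<close>

lemma nabla_coord_field_direction:
  assumes c: "c \<in> charts_at M p" and v: "v \<in> tangent_space M p"
  shows "nabla p v (coord_field M c j) =
    (\<Sum>i\<in>UNIV. (v c $ i) *\<^sub>R nabla p (coord_field M c i p) (coord_field M c j))"
proof -
  have U: "open (fst c)" "fst c \<subseteq> carrier_of M" "p \<in> fst c" "c \<in> Atlas M"
    using c open_chart chart_subset_carrier by (auto simp: charts_at_iff)
  note Y = smooth_coord_field[OF U(4,1) subset_refl]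
  show ?thesis
    by (subst (1) tangent_expansion[OF v c])
      (simp add: sum_3 c nabla_add_direction[OF U(1,2) Y U(3)] nabla_scaleR_direction[OF U(1,2) Y U(3)])
qed

lemma smooth_christoffel:
  assumes c: "c \<in> Atlas M"
  shows "smooth_on (snd c ` fst c)
    (\<lambda>x. nabla (cinv c x) (coord_field M c i (cinv c x)) (coord_field M c j) c)"
proof -
  have "smooth_field_on M (fst c) (\<lambda>p. nabla p (coord_field M c i p) (coord_field M c j))"
    using conjunct2[OF mp[OF spec[OF mp[OF spec[OF nabla[unfolded affine_connection_def]]
      conjI[OF open_chart[OF c] chart_subset_carrier[OF c]]]]
      smooth_coord_field[OF c open_chart[OF c] subset_refl, of j]]]
      smooth_coord_field[OF c open_chart[OF c] subset_refl, of i] by simp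
  then have "smooth_on (snd c ` (fst c \<inter> fst c))
      (\<lambda>x. nabla (cinv c x) (coord_field M c i (cinv c x)) (coord_field M c j) c)"
    using c unfolding smooth_field_on_def by blast
  then show ?thesis
    by simp
qed

text \<open>The inhomogeneous transformation law of the Christoffel symbols: near \<open>p\<close>
  the field \<open>coord_field M c j\<close> is the combination of the fields of \<open>d\<close>
  with coefficients \<open>J\<close>, and the Leibniz rule applies. The first summand contains
  second derivatives of the transition map.\<close>

lemma nabla_coord_field_change:
  assumes c: "c \<in> charts_at M p" and d: "d \<in> charts_at M p" and v: "v \<in> tangent_space M p"
    and J: "\<And>x. J x = frechet_derivative (\<lambda>x. snd d (cinv c x)) (at x) (axis j 1)"
  shows "nabla p v (coord_field M c j) d = frechet_derivative J (at (snd c p)) (v c)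
    + (\<Sum>k\<in>UNIV. (J (snd c p) $ k) *\<^sub>R nabla p v (coord_field M d k) d)"
proof -
  define U where "U = fst c \<inter> fst d"
  have cd: "c \<in> Atlas M" "d \<in> Atlas M"
    using c d by (auto simp: charts_at_iff)
  have U: "open U" "U \<subseteq> carrier_of M" "p \<in> U"
    using c d open_chart[of c] open_chart[of d] chart_subset_carrier[of c]
    by (auto simp: charts_at_iff U_def)
  have J_smooth: "smooth_on (snd c ` U) J"
    using jac_smooth[OF cd, of "axis j 1"] by (simp add: J[abs_def] U_def)
  have f: "smooth_function_on M U (\<lambda>q. J (snd c q) $ k)" for k
    unfolding smooth_function_on_def o_def
  proof
    fix e
    assume e: "e \<in> Atlas M"
    show "smooth_on (snd e ` (fst e \<inter> U)) (\<lambda>x. J (snd c (cinv e x)) $ k)"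
    proof (rule smooth_on_change_chart[OF cd(1) e U(1), where F = "\<lambda>q. J (snd c q) $ k"])
      show "smooth_on (snd c ` U) (\<lambda>x. J x $ k)"
        using open_chart_image[OF cd(1) U(1)] J_smooth
        by (intro smooth_on_nth) (auto simp: U_def Int_absorb1 inf.commute)
    qed (auto simp: U_def)
  qed
  have df: "dir_deriv M p v (\<lambda>q. J (snd c q) $ k) =
      frechet_derivative J (at (snd c p)) (v c) $ k" for k
  proof (rule dir_deriv_chart[OF c v U(1,3)])
    show "((\<lambda>x. J x $ k) has_derivative (\<lambda>x. frechet_derivative J (at (snd c p)) x $ k))
        (at (snd c p))"
      using U(3) by (intro bounded_linear.has_derivative[OF bounded_linear_vec_nth]
          smooth_on_has_derivative[OF J_smooth]) auto
  qed simp
  have d_field: "smooth_field_on M U (coord_field M d k)" for k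
    by (rule smooth_coord_field[OF cd(2) U(1)]) (simp add: U_def)
  define Z where "Z k = (\<lambda>q. (J (snd c q) $ k) *\<^sub>R coord_field M d k q)" for k
  have Z: "smooth_field_on M U (Z k)" for k
    unfolding Z_def by (rule smooth_field_on_scaleR[OF U(1) f d_field])
  have nabla_Z: "nabla p v (Z k) = (frechet_derivative J (at (snd c p)) (v c) $ k) *\<^sub>R coord_field M d k p
      + (J (snd c p) $ k) *\<^sub>R nabla p v (coord_field M d k)" for k
    unfolding Z_def by (simp add: nabla_scaleR[OF U(1,2) d_field U(3) v f] df)
  \<comment> \<open>The three terms are added one at a time, since additivity of the connection
    concerns two smooth fields.\<close>
  have Z12: "smooth_field_on M U (\<lambda>q. Z 1 q + Z 2 q)"
    by (rule smooth_field_on_add[OF U(1) Z Z])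
  have "nabla p v (coord_field M c j) = nabla p v (\<lambda>q. (Z 1 q + Z 2 q) + Z 3 q)"
  proof (rule nabla_cong[OF U(1,2) smooth_field_on_add[OF U(1) Z12 Z] U(3) v])
    fix q
    assume "q \<in> U"
    then have cq: "c \<in> charts_at M q" "d \<in> charts_at M q"
      using cd by (auto simp: charts_at_iff U_def)
    then have "coord_field M c j q d = J (snd c q)"
      by (simp add: coord_field_def jac_eq J)
    then show "coord_field M c j q = (Z 1 q + Z 2 q) + Z 3 q"
      using tangent_expansion[OF coord_field_tangent[OF cq(1)] cq(2), of j]
      by (simp add: Z_def sum_3)
  qed
  also have "\<dots> = (\<Sum>k\<in>UNIV. nabla p v (Z k))"
    by (simp add: nabla_add[OF U(1,2) Z12 U(3) v Z] nabla_add[OF U(1,2) Z U(3) v Z] sum_3)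
  finally have "nabla p v (coord_field M c j) d =
      (\<Sum>k\<in>UNIV. (frechet_derivative J (at (snd c p)) (v c) $ k) *\<^sub>R axis k 1)
      + (\<Sum>k\<in>UNIV. (J (snd c p) $ k) *\<^sub>R nabla p v (coord_field M d k) d)"
    using d by (simp add: nabla_Z sum_fun_apply sum.distrib)
  then show ?thesis
    using basis_expansion[of "frechet_derivative J (at (snd c p)) (v c)"]
    by (simp add: scalar_mult_eq_scaleR)
qed

section \<open>The curve and smooth fields along it\<close>

lemma open_dom: "c \<in> Atlas M \<Longrightarrow> open (dom c)"
  using curve open_chart[of c] continuous_on_open_vimage[of UNIV \<alpha>]
  by (auto simp: smooth_curve_def vimage_def)

lemma smooth_curve_chart: "c \<in> Atlas M \<Longrightarrow> smooth_on (dom c) (\<lambda>s. snd c (\<alpha> s))"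
  using curve by (simp add: smooth_curve_def o_def)

lemma curve_carrier [simp]: "\<alpha> s \<in> carrier_of M"
  using curve by (auto simp: smooth_curve_def)

lemma curve_chart: obtains c where "c \<in> charts_at M (\<alpha> s)"
  using that curve_carrier[of s] unfolding carrier_of_def charts_at_iff by blast

lemma smooth_along_chart:
  assumes c: "c \<in> Atlas M" and f: "smooth_on (snd c ` fst c) (\<lambda>x. f (cinv c x))"
  shows "smooth_on (dom c) (\<lambda>s. f (\<alpha> s))"
proof -
  have "smooth_on (dom c) (\<lambda>s. f (cinv c (snd c (\<alpha> s))))"
    by (rule smooth_on_compose[OF open_dom[OF c] _ smooth_curve_chart[OF c] f])
      (use open_chart_image[OF c open_UNIV] in auto)
  then show ?thesis
    by (rule smooth_on_cong[OF open_dom[OF c]]) (use c in auto)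
qed

lemma velocity_chart:
  assumes c: "c \<in> charts_at M (\<alpha> s)"
  shows "((\<lambda>t. snd c (\<alpha> t)) has_vector_derivative velocity M \<alpha> s c) (at s)"
proof -
  have "((\<lambda>t. snd c (\<alpha> t)) has_vector_derivative vector_derivative (\<lambda>t. snd c (\<alpha> t)) (at s)) (at s)"
    by (rule smooth_on_has_vector_derivative[OF smooth_curve_chart]) (use c in \<open>auto simp: charts_at_iff\<close>)
  then show ?thesis
    using c by (simp add: velocity_def o_def)
qed

lemma derivative_along_curve:
  assumes c: "c \<in> charts_at M (\<alpha> s)" and G: "(G has_derivative G') (at (snd c (\<alpha> s)))"
  shows "((\<lambda>t. G (snd c (\<alpha> t))) has_vector_derivative G' (velocity M \<alpha> s c)) (at s)"
  using has_derivative_compose[OF velocity_chart[OF c, unfolded has_vector_derivative_def] G]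
    linear_scale[OF has_derivative_linear[OF G]]
  by (simp add: has_vector_derivative_def)

lemma velocity_tangent [simp]: "velocity M \<alpha> s \<in> tangent_space M (\<alpha> s)"
proof (rule tangent_spaceI)
  fix c d
  assume c: "c \<in> charts_at M (\<alpha> s)" and d: "d \<in> charts_at M (\<alpha> s)"
  have "((\<lambda>t. snd d (\<alpha> t)) has_vector_derivative jac c d (\<alpha> s) (velocity M \<alpha> s c)) (at s)"
    by (rule has_vector_derivative_transform_within_open[OF
          derivative_along_curve[OF c jac_has_derivative[OF c d]] open_dom[of c]])
      (use c in \<open>auto simp: charts_at_iff\<close>)
  then show "jac c d (\<alpha> s) (velocity M \<alpha> s c) = velocity M \<alpha> s d"
    using velocity_chart[OF d] vector_derivative_unique_at by metis
qed (simp add: velocity_def)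

lemma along_tangent: "smooth_field_along M \<alpha> V \<Longrightarrow> V s \<in> tangent_space M (\<alpha> s)"
  by (simp add: smooth_field_along_def)

lemma along_smooth: "smooth_field_along M \<alpha> V \<Longrightarrow> c \<in> Atlas M \<Longrightarrow> smooth_on (dom c) (\<lambda>s. V s c)"
  by (simp add: smooth_field_along_def)

lemma along_vector_derivative:
  assumes "smooth_field_along M \<alpha> V" "c \<in> charts_at M (\<alpha> s)"
  shows "((\<lambda>t. V t c) has_vector_derivative vector_derivative (\<lambda>t. V t c) (at s)) (at s)"
  by (rule smooth_on_has_vector_derivative[OF along_smooth[OF assms(1)]])
    (use assms(2) in \<open>auto simp: charts_at_iff\<close>)

lemma smooth_along_velocity: "smooth_field_along M \<alpha> (velocity M \<alpha>)"
  unfolding smooth_field_along_def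
proof (intro conjI ballI allI)
  fix c
  assume c: "c \<in> Atlas M"
  show "smooth_on (dom c) (\<lambda>s. velocity M \<alpha> s c)"
    by (rule smooth_on_cong[OF open_dom[OF c]
          smooth_on_vector_derivative[OF open_dom[OF c] smooth_curve_chart[OF c]]])
      (use c in \<open>simp add: velocity_def o_def charts_at_iff\<close>)
qed simp

lemma smooth_along_zero: "smooth_field_along M \<alpha> (\<lambda>s. 0)"
  by (simp add: smooth_field_along_def smooth_on_const)

lemma smooth_along_add:
  "smooth_field_along M \<alpha> V \<Longrightarrow> smooth_field_along M \<alpha> W \<Longrightarrow> smooth_field_along M \<alpha> (\<lambda>s. V s + W s)"
  by (auto simp: smooth_field_along_def intro!: smooth_on_add open_dom)

text \<open>The coefficient is asked to be smooth only on the parameter set of each chart, the form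
  in which \<open>smooth_metric_along\<close> delivers inner products.\<close>

lemma smooth_along_scaleR:
  "(\<And>c. c \<in> Atlas M \<Longrightarrow> smooth_on (dom c) f) \<Longrightarrow> smooth_field_along M \<alpha> V \<Longrightarrow>
    smooth_field_along M \<alpha> (\<lambda>s. f s *\<^sub>R V s)"
  by (auto simp: smooth_field_along_def intro!: smooth_on_scaleR open_dom)

lemma smooth_along_diff:
  "smooth_field_along M \<alpha> V \<Longrightarrow> smooth_field_along M \<alpha> W \<Longrightarrow> smooth_field_along M \<alpha> (\<lambda>s. V s - W s)"
  by (auto simp: smooth_field_along_def intro!: smooth_on_diff open_dom)

lemma smooth_gram_along: "c \<in> Atlas M \<Longrightarrow> smooth_on (dom c) (\<lambda>s. gram c (\<alpha> s) $ i $ j)"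
  by (rule smooth_along_chart[OF _ smooth_gram])

lemma smooth_metric_along:
  assumes V: "smooth_field_along M \<alpha> V" and W: "smooth_field_along M \<alpha> W" and c: "c \<in> Atlas M"
  shows "smooth_on (dom c) (\<lambda>s. Metric M (\<alpha> s) (V s) (W s))"
proof (rule smooth_on_cong[OF open_dom[OF c]])
  show "smooth_on (dom c) (\<lambda>s. \<Sum>i\<in>UNIV. V s c $ i * (\<Sum>j\<in>UNIV. gram c (\<alpha> s) $ i $ j * W s c $ j))"
    by (intro smooth_on_sum smooth_on_mult smooth_on_nth open_dom[OF c] along_smooth[OF V c]
        along_smooth[OF W c] smooth_gram_along[OF c])
  show "(\<Sum>i\<in>UNIV. V s c $ i * (\<Sum>j\<in>UNIV. gram c (\<alpha> s) $ i $ j * W s c $ j)) =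
      Metric M (\<alpha> s) (V s) (W s)" if "s \<in> dom c" for s
    using that c along_tangent[OF V] along_tangent[OF W]
    by (subst metric_chart[of c]) (auto simp: charts_at_iff inner_vec_def matrix_vector_mult_def)
qed

lemma smooth_cross_product_along:
  assumes V: "smooth_field_along M \<alpha> V" and W: "smooth_field_along M \<alpha> W"
  shows "smooth_field_along M \<alpha> (\<lambda>s. cross_product M (\<alpha> s) (V s) (W s))"
  unfolding smooth_field_along_def
proof (intro conjI ballI allI)
  fix s
  show "cross_product M (\<alpha> s) (V s) (W s) \<in> tangent_space M (\<alpha> s)"
    using curve_chart[of s] cross_product_unique(1) along_tangent[OF V] along_tangent[OF W] by metis
next
  fix c
  assume c: "c \<in> Atlas M"
  note op = open_dom[OF c]
  have det: "smooth_on (dom c) (\<lambda>s. det (gram c (\<alpha> s)))"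
    by (intro smooth_on_det op smooth_gram_along c)
  have pos: "det (gram c (\<alpha> s)) > 0" if "s \<in> dom c" for s
    using that c det_gram_pos[of c "\<alpha> s"] by (auto simp: charts_at_iff)
  have cross: "smooth_on (dom c) (\<lambda>s. cross3 (V s c) (W s c) $ i)" for i
    using exhaust_3[of i]
    by (elim disjE; simp add: cross3_def;
        intro smooth_on_diff smooth_on_mult smooth_on_nth op along_smooth[OF V c] along_smooth[OF W c])
  show "smooth_on (dom c) (\<lambda>s. cross_product M (\<alpha> s) (V s) (W s) c)"
  proof (rule smooth_on_cong[OF op])
    have entry: "smooth_on (dom c) (\<lambda>s. if j = k
        then sqrt (det (gram c (\<alpha> s))) * cross3 (V s c) (W s c) $ i else gram c (\<alpha> s) $ i $ j)" for i j k
      using smooth_on_mult[OF op smooth_on_sqrt[OF op det pos] cross] smooth_gram_along[OF c]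
      by (cases "j = k") auto
    show "smooth_on (dom c) (\<lambda>s. cross_components (gram c (\<alpha> s)) (V s c) (W s c))"
      unfolding cross_components_def divide_inverse
      by (intro smooth_on_vec smooth_on_mult smooth_on_inverse smooth_on_det op det pos) (simp_all add: entry)
    show "cross_components (gram c (\<alpha> s)) (V s c) (W s c) = cross_product M (\<alpha> s) (V s) (W s) c"
      if "s \<in> dom c" for s
      using that c along_tangent[OF V] along_tangent[OF W]
      by (subst cross_product_unique(3)[of c]) (auto simp: charts_at_iff)
  qed
qed

text \<open>This is the independence of the chart. Differentiating the components in
  \<open>d\<close>, which are the sums of \<open>V t c $ j\<close> times the Jacobian columns
  \<open>J j\<close>, produces the terms \<open>J' j (v c)\<close>. The transformed Christoffel
  symbols produce exactly the same terms, so the Jacobian carries the formula in \<open>c\<close> to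
  the formula in \<open>d\<close>.\<close>

lemma cov_deriv_tangent [simp]:
  assumes V: "smooth_field_along M \<alpha> V"
  shows "D V s \<in> tangent_space M (\<alpha> s)"
proof (rule tangent_spaceI)
  fix c d
  assume c: "c \<in> charts_at M (\<alpha> s)" and d: "d \<in> charts_at M (\<alpha> s)"
  define p where "p = \<alpha> s"
  define v where "v = velocity M \<alpha> s"
  have cd: "c \<in> Atlas M" "d \<in> Atlas M" "p \<in> fst c" "p \<in> fst d"
    using c d by (auto simp: charts_at_iff p_def)
  note c = c[folded p_def] and d = d[folded p_def]
  have v: "v \<in> tangent_space M p"
    by (simp add: v_def p_def)
  define J where "J j x = frechet_derivative (\<lambda>x. snd d (cinv c x)) (at x) (axis j 1)" for j x
  define J' where "J' j = frechet_derivative (J j) (at (snd c p))" for j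
  define V' where "V' = vector_derivative (\<lambda>t. V t c) (at s)"
  define G where "G k = nabla p v (coord_field M d k) d" for k
  have jac: "jac c d q x = (\<Sum>j\<in>UNIV. (x $ j) *\<^sub>R J j (snd c q))"
    if "c \<in> charts_at M q" "d \<in> charts_at M q" for q x
  proof -
    have "jac c d q (\<Sum>j\<in>UNIV. (x $ j) *\<^sub>R axis j 1) = (\<Sum>j\<in>UNIV. (x $ j) *\<^sub>R J j (snd c q))"
      by (simp add: linear_sum[OF jac_linear[OF that]] linear_scale[OF jac_linear[OF that]]
          J_def jac_eq[symmetric])
    then show ?thesis
      using basis_expansion[of x] by (simp add: scalar_mult_eq_scaleR)
  qed
  have J_deriv: "((\<lambda>t. J j (snd c (\<alpha> t))) has_vector_derivative J' j (v c)) (at s)" for j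
    unfolding v_def J'_def p_def
  proof (rule derivative_along_curve)
    have "smooth_on (snd c ` (fst c \<inter> fst d)) (J j)"
      using jac_smooth[OF cd(1,2), of "axis j 1"] by (simp add: J_def[abs_def])
    then show "(J j has_derivative frechet_derivative (J j) (at (snd c (\<alpha> s)))) (at (snd c (\<alpha> s)))"
      by (rule smooth_on_has_derivative) (use cd in \<open>auto simp: p_def\<close>)
  qed (use c in \<open>simp add: p_def\<close>)
  have V_deriv: "((\<lambda>t. V t c $ j) has_vector_derivative V' $ j) (at s)" for j
    using along_vector_derivative[OF V c[unfolded p_def]] unfolding V'_def
    by (rule bounded_linear.has_vector_derivative[OF bounded_linear_vec_nth])
  have "((\<lambda>t. \<Sum>j\<in>UNIV. (V t c $ j) *\<^sub>R J j (snd c (\<alpha> t))) has_vector_derivative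
      (\<Sum>j\<in>UNIV. (V s c $ j) *\<^sub>R J' j (v c) + (V' $ j) *\<^sub>R J j (snd c (\<alpha> s)))) (at s)"
    by (intro has_vector_derivative_sum has_vector_derivative_scaleR J_deriv
        V_deriv[folded has_real_derivative_iff_has_vector_derivative])
  then have "((\<lambda>t. V t d) has_vector_derivative
      (\<Sum>j\<in>UNIV. (V s c $ j) *\<^sub>R J' j (v c) + (V' $ j) *\<^sub>R J j (snd c (\<alpha> s)))) (at s)"
  proof (rule has_vector_derivative_transform_within_open)
    show "open (dom c \<inter> dom d)" "s \<in> dom c \<inter> dom d"
      using cd open_dom[of c] open_dom[of d] by (auto simp: p_def)
    fix t
    assume t: "t \<in> dom c \<inter> dom d"
    then have *: "c \<in> charts_at M (\<alpha> t)" "d \<in> charts_at M (\<alpha> t)"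
      using cd by (auto simp: charts_at_iff)
    show "(\<Sum>j\<in>UNIV. (V t c $ j) *\<^sub>R J j (snd c (\<alpha> t))) = V t d"
      unfolding jac[OF *, symmetric] by (rule tangent_jac[OF along_tangent[OF V] *, symmetric])
  qed
  then have Vd': "vector_derivative (\<lambda>t. V t d) (at s) =
      (\<Sum>j\<in>UNIV. (V s c $ j) *\<^sub>R J' j (v c) + (V' $ j) *\<^sub>R J j (snd c p))"
    unfolding p_def by (rule vector_derivative_at)
  have Vd: "V s d = (\<Sum>j\<in>UNIV. (V s c $ j) *\<^sub>R J j (snd c p))"
    unfolding jac[OF c d, symmetric] using tangent_jac[OF along_tangent[OF V], of c s d] c d
    by (simp add: p_def)
  have U: "open (fst c)" "fst c \<subseteq> carrier_of M"
    using cd open_chart chart_subset_carrier by auto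
  have nabla_c: "jac c d p (nabla p v (coord_field M c j) c) =
      J' j (v c) + (\<Sum>k\<in>UNIV. (J j (snd c p) $ k) *\<^sub>R G k)" for j
    using nabla_coord_field_change[OF c d v, of "J j" j]
      tangent_jac[OF nabla_tangent[OF U smooth_coord_field[OF cd(1) U(1) subset_refl] cd(3) v] c d]
    by (simp add: J_def J'_def G_def)
  have "jac c d p (D V s c) = jac c d p V'
      + (\<Sum>j\<in>UNIV. (V s c $ j) *\<^sub>R jac c d p (nabla p v (coord_field M c j) c))"
    using c by (simp add: cov_deriv_def linear_add[OF jac_linear[OF c d]] linear_sum[OF jac_linear[OF c d]]
        linear_scale[OF jac_linear[OF c d]] p_def[symmetric] v_def[symmetric] V'_def)
  also have "\<dots> = vector_derivative (\<lambda>t. V t d) (at s) + (\<Sum>k\<in>UNIV. (V s d $ k) *\<^sub>R G k)"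
    by (simp add: jac[OF c d, of V'] Vd' Vd nabla_c sum_3 algebra_simps)
  also have "\<dots> = D V s d"
    using d by (simp add: cov_deriv_def p_def[symmetric] v_def[symmetric] G_def)
  finally show "jac c d (\<alpha> s) (D V s c) = D V s d"
    by (simp add: p_def)
qed (simp add: cov_deriv_def)

text \<open>The velocity is expanded in coordinate directions so that only components of smooth
  fields and Christoffel symbols composed with the curve remain.\<close>

lemma smooth_cov_deriv:
  assumes V: "smooth_field_along M \<alpha> V"
  shows "smooth_field_along M \<alpha> (D V)"
  unfolding smooth_field_along_def
proof (intro conjI ballI allI)
  fix c
  assume c: "c \<in> Atlas M"
  note op = open_dom[OF c]
  show "smooth_on (dom c) (\<lambda>s. D V s c)"
  proof (rule smooth_on_cong[OF op])
    have "smooth_on (dom c) (\<lambda>s. nabla (\<alpha> s) (coord_field M c i (\<alpha> s)) (coord_field M c j) c)" for i j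
      by (rule smooth_along_chart[OF c smooth_christoffel[OF c]])
    then show "smooth_on (dom c) (\<lambda>s. vector_derivative (\<lambda>t. V t c) (at s) +
        (\<Sum>j\<in>UNIV. (V s c $ j) *\<^sub>R (\<Sum>i\<in>UNIV. (velocity M \<alpha> s c $ i) *\<^sub>R
          nabla (\<alpha> s) (coord_field M c i (\<alpha> s)) (coord_field M c j) c)))"
      by (intro smooth_on_add smooth_on_sum smooth_on_scaleR smooth_on_nth smooth_on_vector_derivative
          op along_smooth[OF V c] along_smooth[OF smooth_along_velocity c])
    show "vector_derivative (\<lambda>t. V t c) (at s) +
        (\<Sum>j\<in>UNIV. (V s c $ j) *\<^sub>R (\<Sum>i\<in>UNIV. (velocity M \<alpha> s c $ i) *\<^sub>R
          nabla (\<alpha> s) (coord_field M c i (\<alpha> s)) (coord_field M c j) c)) = D V s c"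
      if "s \<in> dom c" for s
    proof -
      have "c \<in> charts_at M (\<alpha> s)"
        using that c by (simp add: charts_at_iff)
      then show ?thesis
        by (simp add: cov_deriv_def nabla_coord_field_direction[where v = "velocity M \<alpha> s"] sum_fun_apply)
    qed
  qed
qed (use V in simp)

lemma cov_deriv_add:
  assumes V: "smooth_field_along M \<alpha> V" and W: "smooth_field_along M \<alpha> W"
  shows "D (\<lambda>t. V t + W t) s = D V s + D W s"
proof
  fix c
  show "D (\<lambda>t. V t + W t) s c = (D V s + D W s) c"
  proof (cases "c \<in> charts_at M (\<alpha> s)")
    case True
    have "vector_derivative (\<lambda>t. V t c + W t c) (at s) =
        vector_derivative (\<lambda>t. V t c) (at s) + vector_derivative (\<lambda>t. W t c) (at s)"
      by (rule vector_derivative_at[OF has_vector_derivative_add[OF V[THEN along_vector_derivative, OF True]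
            W[THEN along_vector_derivative, OF True]]])
    then show ?thesis
      by (simp add: cov_deriv_def sum.distrib scaleR_add_left)
  qed (simp add: cov_deriv_def)
qed

lemma cov_deriv_scaleR:
  assumes V: "smooth_field_along M \<alpha> V" and f: "(f has_real_derivative f') (at s)"
  shows "D (\<lambda>t. f t *\<^sub>R V t) s = f' *\<^sub>R V s + f s *\<^sub>R D V s"
proof
  fix c
  show "D (\<lambda>t. f t *\<^sub>R V t) s c = (f' *\<^sub>R V s + f s *\<^sub>R D V s) c"
  proof (cases "c \<in> charts_at M (\<alpha> s)")
    case True
    have "vector_derivative (\<lambda>t. f t *\<^sub>R V t c) (at s) =
        f s *\<^sub>R vector_derivative (\<lambda>t. V t c) (at s) + f' *\<^sub>R V s c"
      by (rule vector_derivative_at[OF has_vector_derivative_scaleR[OF f along_vector_derivative[OF V True]]])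
    with True show ?thesis
      by (simp add: cov_deriv_def scaleR_add_right scaleR_sum_right)
  \<comment> \<open>Off the charts around the point, \<open>cov_deriv\<close> is 0 by definition;
    the remaining term vanishes because tangent vectors have components 0 there.\<close>
  qed (use along_tangent[OF V, of s] in \<open>simp add: cov_deriv_def tangent_off_chart\<close>)
qed

end

section \<open>The phase of the frame\<close>

lemma has_real_derivative_LBINT:
  fixes f :: "real \<Rightarrow> real"
  assumes "continuous_on UNIV f"
  shows "((\<lambda>s. LBINT x=0..s. f x) has_real_derivative f s) (at s)"
proof -
  \<comment> \<open>The interval from \<open>-r\<close> to \<open>r\<close> contains 0 and has
    \<open>s\<close> in its interior for either sign of \<open>s\<close>, so the derivative within
    it is the full derivative.\<close>
  define r where "r = \<bar>s\<bar> + 1"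
  have "((\<lambda>u. LBINT x=0..u. f x) has_vector_derivative f s) (at s within {-r..r})"
    using interval_integral_FTC2[of "-r" 0 r f s] continuous_on_subset[OF assms]
    by (auto simp: r_def zero_ereal_def)
  moreover have "at s within {-r..r} = at s"
    by (rule at_within_interior) (auto simp: r_def interior_atLeastAtMost_real)
  ultimately show ?thesis
    by (simp add: has_real_derivative_iff_has_vector_derivative)
qed

lemma has_vector_derivative_torsion_phase:
  assumes "continuous_on UNIV \<tau>"
  shows "(torsion_phase \<tau> has_vector_derivative of_real (\<tau> s) * (\<i> * torsion_phase \<tau> s)) (at s)"
proof -
  have "((\<lambda>s. \<i> * of_real (LBINT x=0..s. \<tau> x)) has_vector_derivative \<i> * of_real (\<tau> s)) (at s)"
    by (intro has_vector_derivative_mult_right has_vector_derivative_of_real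
        has_real_derivative_LBINT[OF assms])
  then have "((\<lambda>s. exp (\<i> * of_real (LBINT x=0..s. \<tau> x))) has_vector_derivative
      \<i> * of_real (\<tau> s) * exp (\<i> * of_real (LBINT x=0..s. \<tau> x))) (at s)"
    using field_vector_diff_chain_at[OF _ DERIV_exp] by (auto simp: o_def)
  then show ?thesis
    by (simp add: torsion_phase_def[abs_def] mult_ac)
qed

text \<open>Bootstrapping in the linear equation for the phase: its derivative is a smooth multiple
  of the phase itself, so each order of differentiability gives the next.\<close>

lemma smooth_torsion_phase:
  assumes \<tau>: "smooth_on UNIV \<tau>"
  shows "smooth_on UNIV (torsion_phase \<tau>)"
proof -
  have cont: "continuous_on UNIV \<tau>"
    using \<tau> Ck_on.simps(1) smooth_on_def by blast
  note deriv = has_vector_derivative_torsion_phase[OF cont, unfolded has_vector_derivative_def]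
  have "Ck_on k (torsion_phase \<tau>) UNIV" for k
  proof (induction k)
    case 0
    have "isCont (torsion_phase \<tau>) s" for s
      using deriv has_derivative_continuous by blast
    then show ?case
      by (simp add: continuous_at_imp_continuous_on)
  next
    case (Suc k)
    have "Ck_on k \<tau> UNIV"
      using \<tau> by (simp add: smooth_on_def)
    then have "Ck_on k (\<lambda>s. of_real (\<tau> s) :: complex) UNIV"
      by (rule Ck_on_linear[OF open_UNIV bounded_linear_of_real])
    then have *: "Ck_on k (\<lambda>s. of_real (\<tau> s) * (\<i> * torsion_phase \<tau> s)) UNIV"
      by (rule Ck_on_bilinear[OF open_UNIV bounded_bilinear_mult _
            Ck_on_bilinear[OF open_UNIV bounded_bilinear_mult Ck_on_const Suc.IH]])
    show ?case
      by (rule Ck_on_SucI[OF open_UNIV deriv])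
        (rule Ck_on_bilinear[OF open_UNIV bounded_bilinear_scaleR Ck_on_const *])
  qed
  then show ?thesis
    by (simp add: smooth_on_def)
qed

lemma norm_torsion_phase: "norm (torsion_phase \<tau> s) = 1"
  by (simp add: torsion_phase_def)

text \<open>The coefficient of \<open>N + \<i> B\<close> in the second frame vector; the root of 2
  compensates the length of \<open>N + \<i> B\<close>.\<close>

definition frame_phase :: "(real \<Rightarrow> real) \<Rightarrow> real \<Rightarrow> complex"
  where "frame_phase \<tau> s = torsion_phase \<tau> s / of_real (sqrt 2)"

text \<open>The equation \<open>p' = \<i> \<tau> p\<close> split into real parts, because
  complexified fields are pairs of real fields and \<open>cov_deriv\<close> acts on each
  separately.\<close>

lemma has_real_derivative_frame_phase:
  assumes "continuous_on UNIV \<tau>"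
  shows "((\<lambda>s. Re (frame_phase \<tau> s)) has_real_derivative - \<tau> s * Im (frame_phase \<tau> s)) (at s)"
    and "((\<lambda>s. Im (frame_phase \<tau> s)) has_real_derivative \<tau> s * Re (frame_phase \<tau> s)) (at s)"
proof -
  have *: "(frame_phase \<tau> has_vector_derivative
      of_real (\<tau> s) * (\<i> * torsion_phase \<tau> s) / of_real (sqrt 2)) (at s)"
    unfolding frame_phase_def[abs_def]
    by (intro has_vector_derivative_divide has_vector_derivative_torsion_phase assms)
  from bounded_linear.has_vector_derivative[OF bounded_linear_Re *]
    bounded_linear.has_vector_derivative[OF bounded_linear_Im *]
  show "((\<lambda>s. Re (frame_phase \<tau> s)) has_real_derivative - \<tau> s * Im (frame_phase \<tau> s)) (at s)"
    "((\<lambda>s. Im (frame_phase \<tau> s)) has_real_derivative \<tau> s * Re (frame_phase \<tau> s)) (at s)"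
    by (simp_all add: has_real_derivative_iff_has_vector_derivative frame_phase_def)
qed

lemma smooth_frame_phase:
  assumes "smooth_on UNIV \<tau>"
  shows "smooth_on S (\<lambda>s. Re (frame_phase \<tau> s))" "smooth_on S (\<lambda>s. Im (frame_phase \<tau> s))"
proof -
  have *: "smooth_on UNIV (frame_phase \<tau>)"
    unfolding frame_phase_def[abs_def] divide_inverse
    by (intro smooth_on_mult smooth_on_const smooth_torsion_phase assms open_UNIV)
  show "smooth_on S (\<lambda>s. Re (frame_phase \<tau> s))" "smooth_on S (\<lambda>s. Im (frame_phase \<tau> s))"
    by (rule smooth_on_subset[OF smooth_on_linear[OF open_UNIV bounded_linear_Re *] subset_UNIV],
        rule smooth_on_subset[OF smooth_on_linear[OF open_UNIV bounded_linear_Im *] subset_UNIV])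
qed

lemma frame_phase_norm:
  "Re (frame_phase \<tau> s) * Re (frame_phase \<tau> s) + Im (frame_phase \<tau> s) * Im (frame_phase \<tau> s) = 1 / 2"
proof -
  have "(Re (frame_phase \<tau> s))\<^sup>2 + (Im (frame_phase \<tau> s))\<^sup>2 = (norm (frame_phase \<tau> s))\<^sup>2"
    by (rule cmod_power2[symmetric])
  also have "\<dots> = 1 / 2"
    by (simp add: frame_phase_def norm_divide norm_torsion_phase power_divide)
  finally show ?thesis
    by (simp add: power2_eq_square)
qed

lemma hasimoto_eq_frame_phase: "(1 / sqrt 2) *\<^sub>R hasimoto \<kappa> \<tau> s = of_real (\<kappa> s) * frame_phase \<tau> s"
  by (simp add: hasimoto_def frame_phase_def scaleR_conv_of_real)

section \<open>The Frenet frame\<close>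

locale frenet_curve = curve_in_3_manifold M nabla \<alpha>
  for M :: "'m::{t2_space, second_countable_topology} riem" and nabla \<alpha> +
  assumes arclength: "arclength_parametrized M \<alpha>"
    and trace_nonzero: "trace_second_fundamental_form M nabla \<alpha> s \<noteq> 0"
begin

abbreviation T where "T \<equiv> frenet_T M \<alpha>"
abbreviation N where "N \<equiv> frenet_N M nabla \<alpha>"
abbreviation B where "B \<equiv> frenet_B M nabla \<alpha>"
abbreviation g where "g s \<equiv> Metric M (\<alpha> s)"
abbreviation h where "h s \<equiv> hermitian_ext M (\<alpha> s)"

lemma frenet_T_eq_velocity: "T s = velocity M \<alpha> s"
  using arclength by (simp add: frenet_T_def arclength_parametrized_def)

lemma smooth_along_T: "smooth_field_along M \<alpha> T"
  using smooth_along_velocity by (simp add: frenet_T_eq_velocity[abs_def])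

lemma T_tangent [simp]: "T s \<in> tangent_space M (\<alpha> s)"
  by (simp add: frenet_T_eq_velocity)

lemma T_unit [simp]: "g s (T s) (T s) = 1"
  using arclength by (simp add: frenet_T_eq_velocity arclength_parametrized_def tnorm_def)

lemma normal_part_tangent [simp]:
  "X \<in> tangent_space M (\<alpha> s) \<Longrightarrow> normal_part M \<alpha> s X \<in> tangent_space M (\<alpha> s)"
  by (simp add: normal_part_def)

lemma normal_part_orthogonal:
  "X \<in> tangent_space M (\<alpha> s) \<Longrightarrow> g s (normal_part M \<alpha> s X) (T s) = 0"
  by (simp add: normal_part_def)

text \<open>As \<open>T s\<close> is nonzero, any admissible \<open>a\<close> and \<open>f\<close>
  satisfy \<open>a = 1\<close> and \<open>f s = 1\<close>. The Leibniz rule then changes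
  \<open>D T s\<close> only by a multiple of \<open>T s\<close>, which the normal projection kills.
  So the value does not depend on the extension of the tangent vector.\<close>

lemma trace_eq_normal_part:
  "trace_second_fundamental_form M nabla \<alpha> s = normal_part M \<alpha> s (D T s)"
  unfolding trace_second_fundamental_form_def second_fundamental_form_def
    frenet_T_eq_velocity[symmetric]
proof (rule the_equality)
  have T0: "T s \<noteq> 0"
    using T_unit[of s] metric_zero_left[of "\<alpha> s" 0] by (metis curve_carrier tangent_zero zero_neq_one)
  show "\<forall>a f. smooth_on UNIV f \<and> T s = a *\<^sub>R T s \<and> T s = f s *\<^sub>R T s \<longrightarrow>
      normal_part M \<alpha> s (D T s) = normal_part M \<alpha> s (a *\<^sub>R D (\<lambda>t. f t *\<^sub>R T t) s)"
  proof (intro allI impI, elim conjE)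
    fix a and f :: "real \<Rightarrow> real"
    assume f: "smooth_on UNIV f" and a1: "T s = a *\<^sub>R T s" and fs: "T s = f s *\<^sub>R T s"
    have scale: "c = 1" if "T s = c *\<^sub>R T s" for c
    proof -
      have "(c - 1) *\<^sub>R T s = 0"
        using that by (simp add: scaleR_diff_left)
      then show ?thesis
        using T0 by simp
    qed
    have "(f has_real_derivative vector_derivative f (at s)) (at s)"
      using smooth_on_has_vector_derivative[OF f, of s]
      by (simp add: has_real_derivative_iff_has_vector_derivative)
    from cov_deriv_scaleR[OF smooth_along_T this] scale[OF a1] scale[OF fs]
    show "normal_part M \<alpha> s (D T s) = normal_part M \<alpha> s (a *\<^sub>R D (\<lambda>t. f t *\<^sub>R T t) s)"
      by (simp add: normal_part_def smooth_along_T scaleR_add_left)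
  qed
next
  fix W
  assume "\<forall>a f. smooth_on UNIV f \<and> T s = a *\<^sub>R T s \<and> T s = f s *\<^sub>R T s \<longrightarrow>
      W = normal_part M \<alpha> s (a *\<^sub>R D (\<lambda>t. f t *\<^sub>R T t) s)"
  \<comment> \<open>The constant extension with \<open>a = 1\<close> is admissible and already
    determines \<open>W\<close>.\<close>
  from this[rule_format, of "\<lambda>t. 1" 1] show "W = normal_part M \<alpha> s (D T s)"
    by (simp add: smooth_on_const)
qed

lemma smooth_along_trace: "smooth_field_along M \<alpha> (trace_second_fundamental_form M nabla \<alpha>)"
  unfolding trace_eq_normal_part[abs_def] normal_part_def
  by (intro smooth_along_diff smooth_along_scaleR smooth_metric_along smooth_cov_deriv smooth_along_T)

lemma trace_tangent [simp]: "trace_second_fundamental_form M nabla \<alpha> s \<in> tangent_space M (\<alpha> s)"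
  by (rule along_tangent[OF smooth_along_trace])

lemma trace_norm_pos: "g s (trace_second_fundamental_form M nabla \<alpha> s)
    (trace_second_fundamental_form M nabla \<alpha> s) > 0"
  by (rule metric_pos) (simp_all add: trace_nonzero)

lemma smooth_along_N: "smooth_field_along M \<alpha> N"
  unfolding frenet_N_def[abs_def] tnorm_def divide_inverse mult_1
proof (intro smooth_along_scaleR smooth_along_trace smooth_on_inverse smooth_on_sqrt open_dom
    smooth_metric_along)
qed (simp_all add: trace_norm_pos)

lemma N_tangent [simp]: "N s \<in> tangent_space M (\<alpha> s)"
  by (rule along_tangent[OF smooth_along_N])

lemma N_unit [simp]: "g s (N s) (N s) = 1"
  using trace_norm_pos[of s] by (simp add: frenet_N_def tnorm_def less_imp_le)

lemma N_T [simp]: "g s (N s) (T s) = 0"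
  using normal_part_orthogonal[of "D T s" s]
  by (simp add: frenet_N_def trace_eq_normal_part smooth_along_T)

lemma T_N [simp]: "g s (T s) (N s) = 0"
  using metric_sym[of "\<alpha> s" "T s" "N s"] by simp

lemma smooth_along_B: "smooth_field_along M \<alpha> B"
  unfolding frenet_B_def[abs_def]
  by (rule smooth_cross_product_along[OF smooth_along_T smooth_along_N])

lemma B_tangent [simp]: "B s \<in> tangent_space M (\<alpha> s)"
  by (rule along_tangent[OF smooth_along_B])

lemma B_T [simp]: "g s (B s) (T s) = 0"
  and B_N [simp]: "g s (B s) (N s) = 0"
  and B_unit [simp]: "g s (B s) (B s) = 1"
proof -
  obtain c where "c \<in> charts_at M (\<alpha> s)"
    using curve_chart .
  from cross_product_orthonormal[OF this, of "T s" "N s"]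
  show "g s (B s) (T s) = 0" "g s (B s) (N s) = 0" "g s (B s) (B s) = 1"
    by (simp_all add: frenet_B_def)
qed

lemma T_B [simp]: "g s (T s) (B s) = 0"
  and N_B [simp]: "g s (N s) (B s) = 0"
  using metric_sym[of "\<alpha> s" "T s" "B s"] metric_sym[of "\<alpha> s" "N s" "B s"] by simp_all

section \<open>The complex bundle\<close>

lemma fiber_F_tangent:
  assumes "Z \<in> fiber_F M nabla \<alpha> s"
  shows "fst Z \<in> tangent_space M (\<alpha> s)" "snd Z \<in> tangent_space M (\<alpha> s)"
  using assms by (auto simp: fiber_F_def scaleC_def)

lemma fiber_F_diff:
  assumes "V \<in> fiber_F M nabla \<alpha> s" "W \<in> fiber_F M nabla \<alpha> s"
  shows "V - W \<in> fiber_F M nabla \<alpha> s"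
proof -
  obtain a b a' b' where "V = scaleC a (T s, 0) + scaleC b (N s, B s)"
    "W = scaleC a' (T s, 0) + scaleC b' (N s, B s)"
    using assms by (auto simp: fiber_F_def)
  then have "V - W = scaleC (a - a') (T s, 0) + scaleC (b - b') (N s, B s)"
    by (simp add: scaleC_def algebra_simps)
  then show ?thesis
    by (auto simp: fiber_F_def)
qed

text \<open>Lets the connection form be computed without evaluating the projection. The work lies in
  showing that the description \<open>proj_F\<close> denotes anything: an explicit orthogonal
  projection \<open>W\<close> exists, and two candidates differ by a vector of the fiber orthogonal
  to itself.\<close>

lemma hermitian_ext_proj_F:
  assumes V: "fst V \<in> tangent_space M (\<alpha> s)" "snd V \<in> tangent_space M (\<alpha> s)"
    and Z: "Z \<in> fiber_F M nabla \<alpha> s"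
  shows "h s (proj_F M nabla \<alpha> s V) Z = h s V Z"
proof -
  let ?P = "\<lambda>W. W \<in> fiber_F M nabla \<alpha> s \<and> (\<forall>Z\<in>fiber_F M nabla \<alpha> s. h s (V - W) Z = 0)"
  \<comment> \<open>Fourier coefficients in the orthogonal basis \<open>T\<close>,
    \<open>N + \<i> B\<close>; the 2 is the squared length of the second vector.\<close>
  define W where "W = scaleC (h s V (T s, 0)) (T s, 0) + scaleC (h s V (N s, B s) / 2) (N s, B s)"
  have "?P W"
  proof (intro conjI ballI)
    show "W \<in> fiber_F M nabla \<alpha> s"
      by (auto simp: W_def fiber_F_def)
    fix Z
    assume "Z \<in> fiber_F M nabla \<alpha> s"
    then obtain a b where "Z = scaleC a (T s, 0) + scaleC b (N s, B s)"
      by (auto simp: fiber_F_def)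
    then show "h s (V - W) Z = 0"
      using V by (cases V) (simp add: W_def scaleC_def hermitian_ext_def complex_eq_iff algebra_simps)
  qed
  moreover have "W' = W" if "?P W'" for W'
  proof -
    have X: "W - W' \<in> fiber_F M nabla \<alpha> s"
      using that \<open>?P W\<close> fiber_F_diff by blast
    then have "h s (V - W') (W - W') = 0" "h s (V - W) (W - W') = 0"
      using that \<open>?P W\<close> by blast+
    then have "g s (fst (W - W')) (fst (W - W')) + g s (snd (W - W')) (snd (W - W')) = 0"
      using V fiber_F_tangent \<open>?P W\<close> that by (simp add: hermitian_ext_def complex_eq_iff)
    moreover have "g s Y Y \<ge> 0" if "Y \<in> tangent_space M (\<alpha> s)" for Y
      using metric_pos[of "\<alpha> s" Y] that by (cases "Y = 0") (auto simp: less_imp_le)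
    ultimately have "g s (fst (W - W')) (fst (W - W')) = 0" "g s (snd (W - W')) (snd (W - W')) = 0"
      using fiber_F_tangent[OF X] by (metis add_nonneg_eq_0_iff)+
    then have "fst (W - W') = 0" "snd (W - W') = 0"
      using fiber_F_tangent[OF X] metric_eq_zero_iff by (metis curve_carrier)+
    then show ?thesis
      by (auto simp: prod_eq_iff)
  qed
  ultimately have "?P (proj_F M nabla \<alpha> s V)"
    unfolding proj_F_def by (rule theI)
  then have "h s (V - proj_F M nabla \<alpha> s V) Z = 0" "proj_F M nabla \<alpha> s V \<in> fiber_F M nabla \<alpha> s"
    using Z by blast+
  then show ?thesis
    using V Z fiber_F_tangent by (simp add: hermitian_ext_def complex_eq_iff)
qed

section \<open>The frame, its covariant derivative and its connection matrix\<close>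

context
  fixes \<kappa> \<tau> :: "real \<Rightarrow> real" and L :: real
  assumes frenet: "curvature_and_torsion M nabla L \<alpha> \<kappa> \<tau>"
begin

abbreviation p where "p \<equiv> frame_phase \<tau>"
abbreviation A where "A \<equiv> frame_B M nabla \<alpha> \<tau>"

lemma frame_B_1: "A s 1 = (T s, 0)"
  by (simp add: frame_B_def)

lemma frame_B_2: "A s 2 = (Re (p s) *\<^sub>R N s - Im (p s) *\<^sub>R B s, Re (p s) *\<^sub>R B s + Im (p s) *\<^sub>R N s)"
  by (simp add: frame_B_def frame_phase_def scaleC_def)

lemma frame_B_fiber: "A s j \<in> fiber_F M nabla \<alpha> s"
proof -
  have F: "scaleC a (T s, 0) + scaleC b (N s, B s) \<in> fiber_F M nabla \<alpha> s" for a b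
    by (auto simp: fiber_F_def)
  show ?thesis
    using F[of 1 0] F[of 0 "torsion_phase \<tau> s / of_real (sqrt 2)"]
    by (simp add: frame_B_def scaleC_def)
qed

lemma smooth_torsion: "smooth_on UNIV \<tau>"
  using frenet by (simp add: curvature_and_torsion_def)

lemma continuous_torsion: "continuous_on UNIV \<tau>"
  using smooth_torsion Ck_on.simps(1) smooth_on_def by blast

lemmas smooth_phase = smooth_frame_phase[OF smooth_torsion]
lemmas has_real_derivative_phase = has_real_derivative_frame_phase[OF continuous_torsion]

lemma moving_frame_B: "moving_frame_F M nabla \<alpha> A"
  unfolding moving_frame_F_def
proof (intro conjI allI)
  fix s i j
  show "A s j \<in> fiber_F M nabla \<alpha> s"
    by (rule frame_B_fiber)
  \<comment> \<open>\<open>frame_phase_norm\<close> gives squared modulus 1/2 for the coefficient,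
    against the squared length 2 of \<open>N + \<i> B\<close>.\<close>
  have "h s (A s i) (A s j) = (if i = j then 1 else 0)" if "i \<in> {1,2}" "j \<in> {1,2}"
    using that frame_phase_norm[of \<tau> s]
    by (auto simp: frame_B_1 frame_B_2 hermitian_ext_def complex_eq_iff algebra_simps)
  then show "h s (A s i) (A s j) = (if i = j then 1 else 0)"
    using exhaust_2[of i] exhaust_2[of j] by auto
next
  fix j :: 2
  consider "j = 1" | "j = 2"
    using exhaust_2[of j] by auto
  then have "smooth_field_along M \<alpha> (\<lambda>s. fst (A s j)) \<and> smooth_field_along M \<alpha> (\<lambda>s. snd (A s j))"
    by cases (auto simp: frame_B_1 frame_B_2 smooth_along_T smooth_along_zero
        intro!: smooth_along_add smooth_along_diff smooth_along_scaleR smooth_phase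
          smooth_along_N smooth_along_B)
  then show "smooth_field_along M \<alpha> (\<lambda>s. fst (A s j))" "smooth_field_along M \<alpha> (\<lambda>s. snd (A s j))"
    by auto
qed

lemma cov_deriv_frame_B_1: "cov_deriv_ext M nabla \<alpha> (\<lambda>t. A t 1) s = (\<kappa> s *\<^sub>R N s, 0)"
proof -
  have "D (\<lambda>t. 0) s = 0"
    by (auto simp: cov_deriv_def)
  then show ?thesis
    using frenet by (simp add: cov_deriv_ext_def frame_B_1 curvature_and_torsion_def)
qed

lemma cov_deriv_frame_B_2:
  "cov_deriv_ext M nabla \<alpha> (\<lambda>t. A t 2) s = ((- \<kappa> s * Re (p s)) *\<^sub>R T s, (- \<kappa> s * Im (p s)) *\<^sub>R T s)"
proof -
  have DN: "D N s = - \<kappa> s *\<^sub>R T s + \<tau> s *\<^sub>R B s" and DB: "D B s = - \<tau> s *\<^sub>R N s"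
    using frenet by (simp_all add: curvature_and_torsion_def)
  note smooth = smooth_along_scaleR[OF smooth_phase(1) smooth_along_N]
    smooth_along_scaleR[OF smooth_phase(2) smooth_along_N]
    smooth_along_scaleR[OF smooth_phase(1) smooth_along_B]
    smooth_along_scaleR[OF smooth_phase(2) smooth_along_B]
  \<comment> \<open>The difference in the real part of the second frame vector is read as a sum with
    coefficient \<open>- Im (p t)\<close>, to which the sum and Leibniz rules apply.\<close>
  have smooth_neg: "smooth_field_along M \<alpha> (\<lambda>t. (- Im (p t)) *\<^sub>R B t)"
    by (intro smooth_along_scaleR smooth_on_minus smooth_phase smooth_along_B open_dom)
  note dp = has_real_derivative_phase[of s]
  have "D (\<lambda>t. Re (p t) *\<^sub>R N t + (- Im (p t)) *\<^sub>R B t) s = (- \<kappa> s * Re (p s)) *\<^sub>R T s"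
    unfolding cov_deriv_add[OF smooth(1) smooth_neg] cov_deriv_scaleR[OF smooth_along_N dp(1)]
      cov_deriv_scaleR[OF smooth_along_B DERIV_minus[OF dp(2)]] DN DB
    by (simp add: algebra_simps)
  moreover have "D (\<lambda>t. Re (p t) *\<^sub>R B t + Im (p t) *\<^sub>R N t) s = (- \<kappa> s * Im (p s)) *\<^sub>R T s"
    unfolding cov_deriv_add[OF smooth(3,2)] cov_deriv_scaleR[OF smooth_along_N dp(2)]
      cov_deriv_scaleR[OF smooth_along_B dp(1)] DN DB
    by (simp add: algebra_simps)
  ultimately show ?thesis
    by (simp add: cov_deriv_ext_def frame_B_2)
qed

text \<open>Column \<open>j\<close> pairs the derivative of frame vector \<open>j\<close> with the
  frame. In column 1, \<open>\<kappa> N\<close> is orthogonal to \<open>T\<close> and pairs with the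
  second vector to \<open>\<kappa> * cnj p\<close>. In column 2, the derivative
  \<open>- \<kappa> p T\<close> meets only \<open>T\<close>. By
  \<open>hasimoto_eq_frame_phase\<close>, \<open>\<kappa> p\<close> is Hasimoto's function over
  \<open>sqrt 2\<close>.\<close>

lemma theta_frame_B:
  "theta_F M nabla \<alpha> A s = (1 / sqrt 2) *\<^sub>R
    vector [vector [0, - hasimoto \<kappa> \<tau> s], vector [cnj (hasimoto \<kappa> \<tau> s), 0]]"
proof -
  have "theta_F M nabla \<alpha> A s $ i $ 1 = h s (\<kappa> s *\<^sub>R N s, 0) (A s i)" for i
    unfolding theta_F_def nabla_F_def
    by (simp add: cov_deriv_frame_B_1 hermitian_ext_proj_F frame_B_fiber)
  moreover have "theta_F M nabla \<alpha> A s $ i $ 2 =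
      h s ((- \<kappa> s * Re (p s)) *\<^sub>R T s, (- \<kappa> s * Im (p s)) *\<^sub>R T s) (A s i)" for i
    unfolding theta_F_def nabla_F_def
    by (simp add: cov_deriv_frame_B_2 hermitian_ext_proj_F frame_B_fiber)
  moreover have "(1 / sqrt 2) *\<^sub>R (- hasimoto \<kappa> \<tau> s) = - (of_real (\<kappa> s) * p s)"
    "(1 / sqrt 2) *\<^sub>R cnj (hasimoto \<kappa> \<tau> s) = cnj (of_real (\<kappa> s) * p s)"
    by (simp_all flip: hasimoto_eq_frame_phase)
  ultimately show ?thesis
    by (simp add: vec_eq_iff forall_2 frame_B_1 frame_B_2 hermitian_ext_def complex_eq_iff
        del: scaleR_minus_right)
qed

end

end

theorem mainTheorem2:
  fixes M :: "'m::{t2_space, second_countable_topology} riem"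
    and nabla :: "'m conn"
    and L :: real
    and \<alpha> :: "real \<Rightarrow> 'm"
    and \<kappa> \<tau> :: "real \<Rightarrow> real"
  assumes "oriented_riemannian_3_manifold M"
    and "levi_civita M nabla"
    and "circle_embedding M L \<alpha>"
    and "arclength_parametrized M \<alpha>"
    and "\<And>s. trace_second_fundamental_form M nabla \<alpha> s \<noteq> 0"
    and "curvature_and_torsion M nabla L \<alpha> \<kappa> \<tau>"
  shows "moving_frame_F M nabla \<alpha> (frame_B M nabla \<alpha> \<tau>) \<and>
    (\<forall>s0.
      theta_F M nabla \<alpha> (frame_B M nabla \<alpha> \<tau>) s0 =
        (1 / sqrt 2) *\<^sub>R vector [vector [0, - hasimoto \<kappa> \<tau> s0],
                                    vector [cnj (hasimoto \<kappa> \<tau> s0), 0]] \<and>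
      theta_F M nabla \<alpha> (frame_B M nabla \<alpha> \<tau>) s0 \<in> u2)"
proof -
  interpret frenet_curve M nabla \<alpha>
    by unfold_locales (use assms in \<open>auto simp: levi_civita_def circle_embedding_def\<close>)
  show ?thesis
    using moving_frame_B[OF assms(6)] theta_frame_B[OF assms(6)]
    by (simp add: u2_def forall_2)
qed

end
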